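(* Let $T\subset\mathbb{R}^2$ be a (non-degenerate) triangle with vertices $p_0,p_1,p_2$, and for each $n$ let $L_n$ be the length of a longest convex chain (from $p_0$ to $p_2$) in a sample of $n$ independent uniform random points of $T$. For every $\gamma>0$ there exists a constant $N$ such that for every $n>N$ $$\mathbb{P}\big(|L_n-\mathbb{E}L_n|>\gamma\sqrt{\log n}\;n^{1/6}\big)<n^{-\gamma^2/14}.$$
   Context: Let $T$ be a triangle with vertices $p_0,p_1,p_2$ and let $X\subset T$ be finite. A subset $Y\subset X$ is a convex chain in $T$ (from $p_0$ to $p_2$) if the convex hull of $Y\cup\{p_0,p_2\}$ is a convex polygon with exactly $|Y|+2$ vertices. The length of the convex chain $Y$ is $|Y|$. $X_n$ denotes a random sample of $n$ independent points, each uniformly distributed in $T$ (normalized Lebesgue measure), and $L_n$ is the maximum of $|Y|$ over all convex chains $Y\subset X_n$ from $p_0$ to $p_2$. $\log$ is the natural logarithm. *)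

theory Defs
  imports "HOL-Analysis.Analysis" "HOL-Probability.Probability"
begin

text \<open>The vertices of a convex polygon are its extreme points. A segment counts as the
  degenerate polygon with two vertices, so that the empty set is a convex chain of length 0;
  a planar polytope with at least three extreme points has nonempty interior.\<close>

definition convex_polygon :: "nat \<Rightarrow> (real ^ 2) set \<Rightarrow> bool" where
  "convex_polygon k P \<longleftrightarrow> polytope P \<and> card {v. v extreme_point_of P} = k"

definition triangle_hull :: "real ^ 2 \<Rightarrow> real ^ 2 \<Rightarrow> real ^ 2 \<Rightarrow> (real ^ 2) set" where
  "triangle_hull p0 p1 p2 = convex hull {p0, p1, p2}"

definition convex_chain :: "real ^ 2 \<Rightarrow> real ^ 2 \<Rightarrow> real ^ 2 \<Rightarrow> (real ^ 2) set \<Rightarrow> bool" where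
  "convex_chain p0 p1 p2 Y \<longleftrightarrow>
     finite Y \<and> Y \<subseteq> triangle_hull p0 p1 p2 \<and>
     convex_polygon (card Y + 2) (convex hull (Y \<union> {p0, p2}))"

definition longest_chain :: "real ^ 2 \<Rightarrow> real ^ 2 \<Rightarrow> real ^ 2 \<Rightarrow> (real ^ 2) set \<Rightarrow> nat" where
  "longest_chain p0 p1 p2 X = Max {card Y |Y. Y \<subseteq> X \<and> convex_chain p0 p1 p2 Y}"

text \<open>The \<open>n\<close> random points are \<open>X 0, \<dots>, X (n - 1)\<close>; independence includes their measurability.\<close>

definition uniform_sample ::
  "'w measure \<Rightarrow> (real ^ 2) set \<Rightarrow> nat \<Rightarrow> (nat \<Rightarrow> 'w \<Rightarrow> real ^ 2) \<Rightarrow> bool" where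
  "uniform_sample M T n X \<longleftrightarrow>
     prob_space M \<and>
     prob_space.indep_vars M (\<lambda>_. borel) X {..<n} \<and>
     (\<forall>i<n. distr M lborel (X i) = uniform_measure lborel T)"

definition chain_length ::
  "real ^ 2 \<Rightarrow> real ^ 2 \<Rightarrow> real ^ 2 \<Rightarrow> nat \<Rightarrow> (nat \<Rightarrow> 'w \<Rightarrow> real ^ 2) \<Rightarrow> 'w \<Rightarrow> real" where
  "chain_length p0 p1 p2 n X \<omega> = real (longest_chain p0 p1 p2 ((\<lambda>i. X i \<omega>) ` {..<n}))"

end

theory Submission
  imports Defs "HOL-Real_Asymp.Real_Asymp"
begin

text \<open>
  The length of a longest chain is a self-bounding function of the sample: deleting a point lowers it
  by at most one, and only deletions of the points of one fixed longest chain can lower it. The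
  entropy method of Boucheron, Lugosi and Massart then bounds the moment generating function by that
  of a Poisson variable with the same mean, \<open>E exp (l L) \<le> exp ((exp l - 1) E L)\<close>. With
  \<open>E L \<le> c n\<^bsup>1/3\<^esup>\<close> and \<open>t = \<gamma> (ln n)\<^bsup>1/2\<^esup> n\<^bsup>1/6\<^esup>\<close>, both tails of the deviation are of order
  \<open>exp (- t\<^sup>2 / (2 c n\<^bsup>1/3\<^esup>)) = n powr (- \<gamma>\<^sup>2 / (2 c))\<close>, so that any constant \<open>c < 7\<close> suffices.

  Such a \<open>c\<close> comes from a first-moment bound on chains of length \<open>k\<close>. In the affine coordinates
  that make \<open>p0, p1, p2\<close> the points \<open>(0,0), (1,0), (1,1)\<close>, the steps of a chain lie in the
  positive quadrant, have coordinate sums at most one, and have increasing slopes. An exponential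
  weight decouples the steps, and exchangeability yields a factor \<open>1 / k!\<close> for the order of the
  slopes. A fixed \<open>k\<close>-tuple is thus an ordered chain with probability at most
  \<open>exp (2 k) (4 / k\<^sup>2)\<^sup>k / k!\<close>, and \<open>n\<^sup>k\<close> times this is exponentially small for \<open>k \<ge> 5 n\<^bsup>1/3\<^esup>\<close>.
\<close>

section \<open>Entropy on product spaces\<close>

text \<open>Bounded differences alone would only control fluctuations of order
  \<open>n^(1/2)\<close>. The self-bounding property replaces the number of points by the mean
  length as variance proxy, and the mean is of order \<open>n^(1/3)\<close>; this is where the scale
  \<open>n^(1/6)\<close> comes from. The inequality is centred at the mean and holds for
  \<open>l\<close> of either sign, so both tails follow from it. After centring, the exponent is
  controlled by the size of the mean, so an upper bound on the mean is all that enters. The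
  constants: the tuple count is at most \<open>(4 e^3 n / k^3)^k\<close>, so any \<open>k\<close>
  above \<open>(4 e^3)^(1/3) n^(1/3)\<close>, about \<open>4.32 n^(1/3)\<close>, makes chains of
  length \<open>k\<close> exponentially rare. The value 5 is a round choice above this threshold,
  and rounding leaves the mean below \<open>5.5 n^(1/3)\<close>. The gap between 5.5 and 7 pays for
  the factor 2 of the two tails and for the higher-order terms of the exponential. The room below 7
  also covers a factor 2 given away in the area comparison for the corner
  \<open>cone_below 1\<close>, whose area in fact equals that of the triangle.\<close>

definition avg_coord :: "'a measure \<Rightarrow> 'i \<Rightarrow> (('i \<Rightarrow> 'a) \<Rightarrow> real) \<Rightarrow> ('i \<Rightarrow> 'a) \<Rightarrow> real" where
  "avg_coord M i g x = (\<integral>y. g (x(i := y)) \<partial>M)"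

text \<open>A function of the remaining coordinates is represented by a function on the full product
  that ignores updates at \<open>i\<close>. All functions then live on one space, and statements
  about them mention no product over \<open>I - {i}\<close>.\<close>

definition coord_invariant :: "'a measure \<Rightarrow> 'i set \<Rightarrow> 'i \<Rightarrow> (('i \<Rightarrow> 'a) \<Rightarrow> 'b) \<Rightarrow> bool" where
  "coord_invariant M I i h \<longleftrightarrow>
     (\<forall>x\<in>space (PiM I (\<lambda>_. M)). \<forall>y\<in>space M. h (x(i := y)) = h x)"

lemma measurable_bounded_integrable:
  assumes "prob_space P" "f \<in> borel_measurable P" "\<And>x. x \<in> space P \<Longrightarrow> a \<le> f x \<and> f x \<le> b"
  shows "integrable P (f :: _ \<Rightarrow> real)"
proof -
  interpret prob_space P by fact
  show ?thesis
    by (rule integrable_const_bound[where B="max \<bar>a\<bar> \<bar>b\<bar>"]) (use assms in \<open>force+\<close>)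
qed

context
  fixes M :: "'a measure" and I :: "'i set" and P
  assumes M: "prob_space M" and I: "finite I"
  defines "P \<equiv> PiM I (\<lambda>_. M)"
begin

interpretation M: prob_space M by (rule M)
interpretation PP: product_prob_space "\<lambda>_. M" I by standard
interpretation P: prob_space P unfolding P_def by (rule prob_space_PiM) (rule M)

lemma upd_space: "i \<in> I \<Longrightarrow> x \<in> space P \<Longrightarrow> y \<in> space M \<Longrightarrow> x(i := y) \<in> space P"
  unfolding P_def space_PiM by (auto simp: PiE_def extensional_def)

lemma upd_measurable: "i \<in> I \<Longrightarrow> (\<lambda>(x, y). x(i := y)) \<in> measurable (P \<Otimes>\<^sub>M M) P"
  using measurable_add_dim[of i I "\<lambda>_. M"] unfolding P_def by (simp add: insert_absorb)

lemma avg_coord_measurable: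
  assumes i: "i \<in> I" and g: "g \<in> borel_measurable P"
  shows "avg_coord M i g \<in> borel_measurable P"
proof -
  have "(\<lambda>(x, y). g (x(i := y))) \<in> borel_measurable (P \<Otimes>\<^sub>M M)"
    using measurable_compose[OF upd_measurable[OF i] g] by (simp add: case_prod_unfold)
  then show ?thesis unfolding avg_coord_def
    by (rule M.borel_measurable_lebesgue_integral)
qed

lemma section_measurable:
  assumes i: "i \<in> I" and g: "g \<in> borel_measurable P" and x: "x \<in> space P"
  shows "(\<lambda>y. g (x(i := y))) \<in> borel_measurable M"
proof -
  have "(\<lambda>y. (x, y)) \<in> measurable M (P \<Otimes>\<^sub>M M)" using x by measurable
  from measurable_compose[OF measurable_compose[OF this upd_measurable[OF i]] g]
  show ?thesis by simp
qed

lemma avg_coord_bounds: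
  assumes i: "i \<in> I" and g: "g \<in> borel_measurable P"
    and b: "\<And>x. x \<in> space P \<Longrightarrow> a \<le> g x \<and> g x \<le> b" and x: "x \<in> space P"
  shows "a \<le> avg_coord M i g x \<and> avg_coord M i g x \<le> b"
proof -
  have int: "integrable M (\<lambda>y. g (x(i := y)))"
    by (rule measurable_bounded_integrable[OF M section_measurable[OF i g x]])
       (use b upd_space[OF i x] in auto)
  show ?thesis unfolding avg_coord_def
    using M.integral_ge_const[OF int, of a] M.integral_le_const[OF int, of b] b upd_space[OF i x] by auto
qed

lemma avg_coord_invariant: "coord_invariant M I i (avg_coord M i g)"
  by (simp add: coord_invariant_def avg_coord_def)

lemma avg_coord_invariant_other:
  assumes i: "i \<in> I" and g: "coord_invariant M I j g"
  shows "coord_invariant M I j (avg_coord M i g)"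
proof (cases "i = j")
  case True then show ?thesis by (simp add: avg_coord_invariant)
next
  case False
  show ?thesis unfolding coord_invariant_def
  proof (intro ballI)
    fix x y assume xy: "x \<in> space (PiM I (\<lambda>_. M))" "y \<in> space M"
    have "g (x(j := y, i := z)) = g (x(i := z))" if "z \<in> space M" for z
      using g upd_space[OF i, of x z] xy that False
      by (simp add: coord_invariant_def P_def fun_upd_twist[of j i])
    then show "avg_coord M i g (x(j := y)) = avg_coord M i g x"
      unfolding avg_coord_def by (intro Bochner_Integration.integral_cong) auto
  qed
qed

text \<open>Fubini, applied once to the average and once to \<open>g\<close> itself. The average
  does not depend on its own coordinate, so integrating it over that coordinate changes
  nothing.\<close>

lemma integral_avg_coord:
  assumes i: "i \<in> I" and g: "g \<in> borel_measurable P"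
    and b: "\<And>x. x \<in> space P \<Longrightarrow> a \<le> g x \<and> g x \<le> b"
  shows "(\<integral>x. avg_coord M i g x \<partial>P) = (\<integral>x. g x \<partial>P)"
proof -
  let ?J = "I - {i}"
  have ins: "insert i ?J = I" using i by auto
  note pi = PP.product_integral_insert[of ?J i, unfolded ins, folded P_def]
  have ig: "integrable P g" by (rule measurable_bounded_integrable[OF P.prob_space_axioms g b])
  have iA: "integrable P (avg_coord M i g)"
    by (rule measurable_bounded_integrable[OF P.prob_space_axioms avg_coord_measurable[OF i g] avg_coord_bounds[OF i g b]])
  have "(\<integral>x. avg_coord M i g x \<partial>P) = (\<integral>x. (\<integral>y. avg_coord M i g (x(i := y)) \<partial>M) \<partial>PiM ?J (\<lambda>_. M))"
    by (rule pi) (use I iA in auto)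
  also have "\<dots> = (\<integral>x. avg_coord M i g x \<partial>PiM ?J (\<lambda>_. M))"
    by (simp add: avg_coord_def M.prob_space)
  also have "\<dots> = (\<integral>x. g x \<partial>P)"
    unfolding avg_coord_def by (rule pi[symmetric]) (use I ig in auto)
  finally show ?thesis .
qed

text \<open>The coordinates of \<open>z\<close> are exchanged for those of \<open>x\<close> one at a
  time, and no exchange changes the value of \<open>h\<close>. Finiteness of \<open>I\<close> lets
  the exchange end at \<open>x\<close>.\<close>

lemma invariant_const:
  assumes inv: "\<And>i. i \<in> I \<Longrightarrow> coord_invariant M I i h" and x: "x \<in> space P" and z: "z \<in> space P"
  shows "h x = h z"
proof -
  have "h (\<lambda>i. if i \<in> J then x i else z i) = h z \<and> (\<lambda>i. if i \<in> J then x i else z i) \<in> space P"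
    if "finite J" "J \<subseteq> I" for J using that
  proof induction
    case empty then show ?case using z by simp
  next
    case (insert j J)
    have eq: "(\<lambda>i. if i \<in> insert j J then x i else z i) = (\<lambda>i. if i \<in> J then x i else z i)(j := x j)"
      by auto
    have xj: "x j \<in> space M" using x insert by (auto simp: P_def space_PiM)
    show ?case unfolding eq using insert inv[of j] xj upd_space[of j _ "x j"]
      by (auto simp: coord_invariant_def P_def)
  qed
  from this[OF I] have "h (\<lambda>i. if i \<in> I then x i else z i) = h z" by simp
  also have "(\<lambda>i. if i \<in> I then x i else z i) = x"
    using x z by (auto simp: P_def space_PiM PiE_def extensional_def fun_eq_iff)
  finally show ?thesis .
qed

text \<open>The bound \<open>ln t \<le> t - 1\<close> at \<open>t = g c / (f \<cdot> avg g)\<close>; the average of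
  \<open>g / avg g\<close> over the \<open>i\<close>-th coordinate is \<open>1\<close>, so the terms linear in \<open>c\<close> cancel.
  No relation between \<open>f\<close> and \<open>g\<close> is needed.\<close>

lemma entropy_step:
  assumes i: "i \<in> I" and a: "0 < a"
    and f: "f \<in> borel_measurable P" "\<And>x. x \<in> space P \<Longrightarrow> a \<le> f x \<and> f x \<le> b"
    and g: "g \<in> borel_measurable P" "\<And>x. x \<in> space P \<Longrightarrow> a \<le> g x \<and> g x \<le> b"
    and c: "c \<in> borel_measurable P" "\<And>x. x \<in> space P \<Longrightarrow> a \<le> c x \<and> c x \<le> b"
      "coord_invariant M I i c"
  shows "(\<integral>x. f x * ln (g x) \<partial>P) - (\<integral>x. f x * ln (avg_coord M i g x) \<partial>P)
    \<le> (\<integral>x. f x * ln (f x / c x) - f x + c x \<partial>P)"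
proof -
  let ?h = "avg_coord M i g"
  have h1: "?h \<in> borel_measurable P" and h2: "\<And>x. x \<in> space P \<Longrightarrow> a \<le> ?h x \<and> ?h x \<le> b"
    using avg_coord_measurable[OF i g(1)] avg_coord_bounds[OF i g(1), of a b] g(2) by auto
  note [measurable] = f(1) g(1) c(1) h1
  obtain x0 where x0: "x0 \<in> space P" using P.not_empty by auto
  have ab: "a \<le> b" using f(2)[OF x0] by auto
  have lnb: "\<bar>ln t\<bar> \<le> \<bar>ln a\<bar> + \<bar>ln b\<bar>" if "a \<le> t" "t \<le> b" for t
  proof -
    have "ln a \<le> ln t" "ln t \<le> ln b" using that a by (auto intro!: iffD2[OF ln_le_cancel_iff])
    then show ?thesis by linarith
  qed
  have intln: "integrable P (\<lambda>x. f x * ln (u x))"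
    if u: "u \<in> borel_measurable P" "\<And>x. x \<in> space P \<Longrightarrow> a \<le> u x \<and> u x \<le> b" for u
  proof (rule measurable_bounded_integrable[OF P.prob_space_axioms])
    show "(\<lambda>x. f x * ln (u x)) \<in> borel_measurable P" using u(1) by measurable
    fix x assume x: "x \<in> space P"
    have "\<bar>f x * ln (u x)\<bar> \<le> b * (\<bar>ln a\<bar> + \<bar>ln b\<bar>)"
      unfolding abs_mult by (rule mult_mono) (use f(2)[OF x] u(2)[OF x] a lnb in auto)
    then show "- (b * (\<bar>ln a\<bar> + \<bar>ln b\<bar>)) \<le> f x * ln (u x) \<and> f x * ln (u x) \<le> b * (\<bar>ln a\<bar> + \<bar>ln b\<bar>)"
      by linarith
  qed
  note ints = intln[OF f] intln[OF g] intln[OF c(1,2)] intln[OF h1 h2]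
  have intf: "integrable P f" by (rule measurable_bounded_integrable[OF P.prob_space_axioms f])
  have intc: "integrable P c" by (rule measurable_bounded_integrable[OF P.prob_space_axioms c(1,2)])
  have q: "(\<lambda>x. g x * c x / ?h x) \<in> borel_measurable P" by measurable
  have qb: "0 \<le> g x * c x / ?h x \<and> g x * c x / ?h x \<le> b * b / a" if x: "x \<in> space P" for x
    using g(2)[OF x] c(2)[OF x] h2[OF x] a by (auto intro!: frac_le mult_mono)
  have intq: "integrable P (\<lambda>x. g x * c x / ?h x)"
    by (rule measurable_bounded_integrable[OF P.prob_space_axioms q qb])
  have "(\<integral>x. g x * c x / ?h x \<partial>P) = (\<integral>x. avg_coord M i (\<lambda>x. g x * c x / ?h x) x \<partial>P)"
    by (rule integral_avg_coord[OF i q qb, symmetric])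
  also have "\<dots> = (\<integral>x. c x \<partial>P)"
  proof (rule Bochner_Integration.integral_cong[OF refl])
    fix x assume x: "x \<in> space P"
    have "avg_coord M i (\<lambda>x. g x * c x / ?h x) x = (\<integral>y. g (x(i := y)) * (c x / ?h x) \<partial>M)"
      unfolding avg_coord_def[of M i "\<lambda>x. g x * c x / ?h x"]
      using c(3) avg_coord_invariant[of i g] x
      by (intro Bochner_Integration.integral_cong) (auto simp: coord_invariant_def P_def)
    also have "\<dots> = ?h x * (c x / ?h x)" by (simp add: avg_coord_def)
    also have "\<dots> = c x" using h2[OF x] a by auto
    finally show "avg_coord M i (\<lambda>x. g x * c x / ?h x) x = c x" .
  qed
  finally have E: "(\<integral>x. g x * c x / ?h x \<partial>P) = (\<integral>x. c x \<partial>P)" .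
  have eqR: "(\<integral>x. f x * ln (f x / c x) - f x + c x \<partial>P)
     = (\<integral>x. f x * ln (f x) - f x * ln (c x) - f x + c x \<partial>P)"
    using f(2) c(2) a by (intro Bochner_Integration.integral_cong)
      (force simp: ln_div algebra_simps)+
  have "(\<integral>x. f x * ln (g x) - f x * ln (?h x) \<partial>P)
     \<le> (\<integral>x. f x * ln (f x) - f x * ln (c x) - f x + g x * c x / ?h x \<partial>P)"
  proof (rule integral_mono)
    show "integrable P (\<lambda>x. f x * ln (g x) - f x * ln (?h x))" using ints by auto
    show "integrable P (\<lambda>x. f x * ln (f x) - f x * ln (c x) - f x + g x * c x / ?h x)"
      using ints intf intq by auto
    fix x assume x: "x \<in> space P"
    have pos: "0 < f x" "0 < g x" "0 < c x" "0 < ?h x"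
      using f(2)[OF x] g(2)[OF x] c(2)[OF x] h2[OF x] a by auto
    have "ln (g x * c x / (?h x * f x)) \<le> g x * c x / (?h x * f x) - 1"
      using pos by (intro ln_le_minus_one) simp
    then have "ln (g x) + ln (c x) - ln (?h x) - ln (f x) \<le> g x * c x / (?h x * f x) - 1"
      using pos by (simp add: ln_div ln_mult)
    then have "f x * (ln (g x) + ln (c x) - ln (?h x) - ln (f x)) \<le> f x * (g x * c x / (?h x * f x) - 1)"
      using pos by (intro mult_left_mono) auto
    also have "\<dots> = g x * c x / ?h x - f x" using pos by (simp add: field_simps)
    finally show "f x * ln (g x) - f x * ln (?h x) \<le> f x * ln (f x) - f x * ln (c x) - f x + g x * c x / ?h x"
      by (simp add: algebra_simps)
  qed
  also have "\<dots> = (\<integral>x. f x * ln (f x) - f x * ln (c x) - f x + c x \<partial>P)"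
    using ints intf intq intc E by simp
  finally show ?thesis unfolding eqR using ints by simp
qed

text \<open>The coordinates are averaged out one after the other, starting from
  \<open>g = f\<close>, and the differences given by \<open>entropy_step\<close> telescope. Each of
  them is bounded in terms of the original \<open>f\<close>, not of the current \<open>g\<close>.
  When all coordinates are averaged, \<open>g\<close> is constant and equals the mean of
  \<open>f\<close>. The functions \<open>c i\<close> are free comparison functions: the right-hand
  side is the variational form of the entropy of \<open>f\<close> in each single coordinate.\<close>

theorem entropy_tensorization:
  fixes f :: "('i \<Rightarrow> 'a) \<Rightarrow> real"
  assumes a: "0 < a"
    and f: "f \<in> borel_measurable P" "\<And>x. x \<in> space P \<Longrightarrow> a \<le> f x \<and> f x \<le> b"
    and c: "\<And>i. i \<in> I \<Longrightarrow> c i \<in> borel_measurable P"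
      "\<And>i x. i \<in> I \<Longrightarrow> x \<in> space P \<Longrightarrow> a \<le> c i x \<and> c i x \<le> b"
      "\<And>i. i \<in> I \<Longrightarrow> coord_invariant M I i (c i)"
  shows "(\<integral>x. f x * ln (f x) \<partial>P) - (\<integral>x. f x \<partial>P) * ln (\<integral>x. f x \<partial>P)
    \<le> (\<Sum>i\<in>I. \<integral>x. f x * ln (f x / c i x) - f x + c i x \<partial>P)"
proof -
  have "\<exists>g. g \<in> borel_measurable P \<and> (\<forall>x\<in>space P. a \<le> g x \<and> g x \<le> b) \<and>
      (\<forall>j\<in>J. coord_invariant M I j g) \<and> (\<integral>x. g x \<partial>P) = (\<integral>x. f x \<partial>P) \<and>
      (\<integral>x. f x * ln (f x) \<partial>P) - (\<integral>x. f x * ln (g x) \<partial>P)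
        \<le> (\<Sum>i\<in>J. \<integral>x. f x * ln (f x / c i x) - f x + c i x \<partial>P)"
    if "finite J" "J \<subseteq> I" for J using that
  proof induction
    case empty
    show ?case using f by (intro exI[of _ f]) auto
  next
    case (insert j J)
    then obtain g where g: "g \<in> borel_measurable P" "\<forall>x\<in>space P. a \<le> g x \<and> g x \<le> b"
      "\<forall>j\<in>J. coord_invariant M I j g" "(\<integral>x. g x \<partial>P) = (\<integral>x. f x \<partial>P)"
      "(\<integral>x. f x * ln (f x) \<partial>P) - (\<integral>x. f x * ln (g x) \<partial>P)
        \<le> (\<Sum>i\<in>J. \<integral>x. f x * ln (f x / c i x) - f x + c i x \<partial>P)" by auto
    have j: "j \<in> I" using insert by auto
    have gb: "\<And>x. x \<in> space P \<Longrightarrow> a \<le> g x \<and> g x \<le> b" using g(2) by auto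
    have "(\<integral>x. f x * ln (g x) \<partial>P) - (\<integral>x. f x * ln (avg_coord M j g x) \<partial>P)
      \<le> (\<integral>x. f x * ln (f x / c j x) - f x + c j x \<partial>P)"
      by (rule entropy_step[OF j a f g(1) gb]) (use c j in auto)
    moreover have "a \<le> avg_coord M j g x \<and> avg_coord M j g x \<le> b" if "x \<in> space P" for x
      by (rule avg_coord_bounds[OF j g(1) gb that])
    ultimately show ?case using g insert(1,2) j
      by (intro exI[of _ "avg_coord M j g"] conjI ballI)
        (auto simp: avg_coord_measurable avg_coord_invariant avg_coord_invariant_other
          integral_avg_coord[OF j g(1) gb])
  qed
  from this[OF I] obtain g where g: "g \<in> borel_measurable P"
    "\<forall>j\<in>I. coord_invariant M I j g" "(\<integral>x. g x \<partial>P) = (\<integral>x. f x \<partial>P)"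
    "(\<integral>x. f x * ln (f x) \<partial>P) - (\<integral>x. f x * ln (g x) \<partial>P)
        \<le> (\<Sum>i\<in>I. \<integral>x. f x * ln (f x / c i x) - f x + c i x \<partial>P)" by auto
  obtain x0 where x0: "x0 \<in> space P" using P.not_empty by auto
  have gc: "g x = g x0" if "x \<in> space P" for x
    using invariant_const[of g x x0] g(2) that x0 by auto
  have "(\<integral>x. g x \<partial>P) = (\<integral>x. g x0 \<partial>P)"
    by (intro Bochner_Integration.integral_cong) (auto simp: gc)
  then have g0: "g x0 = (\<integral>x. f x \<partial>P)" using g(3) by (simp add: P.prob_space)
  have "(\<integral>x. f x * ln (g x) \<partial>P) = (\<integral>x. f x * ln (g x0) \<partial>P)"
    by (intro Bochner_Integration.integral_cong refl) (metis gc)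
  also have "\<dots> = (\<integral>x. f x \<partial>P) * ln (\<integral>x. f x \<partial>P)" by (simp add: g0)
  finally show ?thesis using g(4) by simp
qed

end

section \<open>Self-bounding functions\<close>

text \<open>Multiplied by \<open>exp l / F l\<close>, the hypothesis says that
  \<open>H = ln F / (exp - 1)\<close> has nonpositive derivative away from 0. As
  \<open>ln (F 0) = 0\<close>, numerator and denominator of \<open>H\<close> are \<open>t\<close>
  times difference quotients at 0, so \<open>H\<close> tends to \<open>F' 0\<close>. Monotonicity
  compares \<open>H l\<close> with this limit in opposite directions for positive and negative
  \<open>l\<close>, and the sign of \<open>exp l - 1\<close> compensates for that.\<close>

lemma mgf_differential_inequality:
  fixes F F' :: "real \<Rightarrow> real"
  assumes der: "\<And>l. (F has_real_derivative F' l) (at l)" and pos: "\<And>l. 0 < F l" and F0: "F 0 = 1"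
    and ineq: "\<And>l. (1 - exp (- l)) * F' l \<le> F l * ln (F l)"
  shows "ln (F l) \<le> (exp l - 1) * F' 0"
proof -
  define H where "H t = ln (F t) / (exp t - 1)" for t
  define H' where "H' t = (F' t / F t * (exp t - 1) - ln (F t) * exp t) / (exp t - 1)\<^sup>2" for t
  have dH: "(H has_real_derivative H' t) (at t)" if "t \<noteq> 0" for t
    unfolding H_def[abs_def] H'_def using that pos[of t]
    by (auto intro!: derivative_eq_intros der simp: power2_eq_square)
  have H'0: "H' t \<le> 0" for t
  proof -
    have "exp t / F t * ((1 - exp (- t)) * F' t) \<le> exp t / F t * (F t * ln (F t))"
      using pos[of t] by (intro mult_left_mono ineq) auto
    moreover have "exp t / F t * ((1 - exp (- t)) * F' t) = F' t / F t * (exp t - 1)"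
    proof -
      have "exp t * (1 - exp (- t)) = exp t - 1" by (simp add: algebra_simps flip: exp_add)
      then have "exp t / F t * ((1 - exp (- t)) * F' t) = (exp t - 1) * F' t / F t"
        by (metis mult.assoc times_divide_eq_left)
      then show ?thesis by (simp add: mult.commute)
    qed
    moreover have "exp t / F t * (F t * ln (F t)) = ln (F t) * exp t"
      using pos[of t] by simp
    ultimately have "F' t / F t * (exp t - 1) - ln (F t) * exp t \<le> 0" by linarith
    then show ?thesis unfolding H'_def by (simp add: divide_nonpos_nonneg)
  qed
  have anti: "H t \<le> H s" if "s \<le> t" "0 < s \<or> t < 0" for s t
  proof (rule DERIV_nonpos_imp_nonincreasing[OF that(1)])
    fix r assume "s \<le> r" "r \<le> t"
    then have "r \<noteq> 0" using that(2) by auto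
    then show "\<exists>y. DERIV H r :> y \<and> y \<le> 0" using dH H'0 by blast
  qed
  have lim: "(H \<longlongrightarrow> F' 0) (at 0)"
  proof -
    have "((\<lambda>t. ln (F t)) has_real_derivative F' 0) (at 0)"
      using der[of 0] pos[of 0] F0 by (auto intro!: derivative_eq_intros)
    then have 1: "((\<lambda>t. ln (F t) / t) \<longlongrightarrow> F' 0) (at 0)"
      by (simp add: DERIV_def F0)
    have "((\<lambda>t::real. exp t) has_real_derivative 1) (at 0)"
      by (auto intro!: derivative_eq_intros)
    then have 2: "((\<lambda>t::real. (exp t - 1) / t) \<longlongrightarrow> 1) (at 0)"
      by (simp add: DERIV_def)
    have "((\<lambda>t. (ln (F t) / t) / ((exp t - 1) / t)) \<longlongrightarrow> F' 0 / 1) (at 0)"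
      by (intro tendsto_divide 1 2) simp
    then have "((\<lambda>t. (ln (F t) / t) / ((exp t - 1) / t)) \<longlongrightarrow> F' 0) (at 0)" by simp
    then show ?thesis
      by (rule Lim_transform_eventually)
        (auto simp: H_def eventually_at_filter)
  qed
  consider "l = 0" | "l > 0" | "l < 0" by linarith
  then show ?thesis
  proof cases
    case 1 then show ?thesis by (simp add: F0)
  next
    case 2
    have "H l \<le> F' 0"
    proof (rule tendsto_lowerbound)
      show "(H \<longlongrightarrow> F' 0) (at_right 0)" using lim by (rule filterlim_at_split[THEN iffD1, THEN conjunct2])
      show "\<forall>\<^sub>F t in at_right 0. H l \<le> H t"
        using eventually_at_right_real[OF 2] by eventually_elim (auto intro: anti)
    qed simp
    then show ?thesis using 2 by (simp add: H_def field_simps)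
  next
    case 3
    have "F' 0 \<le> H l"
    proof (rule tendsto_upperbound)
      show "(H \<longlongrightarrow> F' 0) (at_left 0)" using lim by (rule filterlim_at_split[THEN iffD1, THEN conjunct1])
      show "\<forall>\<^sub>F t in at_left 0. H t \<le> H l"
        using eventually_at_left_real[OF 3] by eventually_elim (auto intro: anti)
    qed simp
    then show ?thesis using 3 by (simp add: H_def field_simps)
  qed
qed

text \<open>Makes every moment a finite sum, so that the moment generating function can be
  differentiated term by term.\<close>

lemma (in prob_space) expectation_of_bounded_nat:
  fixes Z :: "'a \<Rightarrow> nat" and g :: "nat \<Rightarrow> real"
  assumes Z: "Z \<in> measurable M (count_space UNIV)" and m: "\<And>x. x \<in> space M \<Longrightarrow> Z x \<le> m"
  shows "(\<integral>x. g (Z x) \<partial>M) = (\<Sum>k\<le>m. prob (Z -` {k} \<inter> space M) * g k)"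
proof -
  have sets: "Z -` {k} \<inter> space M \<in> sets M" for k by (rule measurable_sets[OF Z]) simp
  have "(\<integral>x. g (Z x) \<partial>M) = (\<integral>x. (\<Sum>k\<le>m. indicator (Z -` {k} \<inter> space M) x * g k) \<partial>M)"
  proof (rule Bochner_Integration.integral_cong[OF refl])
    fix x assume x: "x \<in> space M"
    have "(\<Sum>k\<le>m. indicator (Z -` {k} \<inter> space M) x * g k) = (\<Sum>k\<le>m. if k = Z x then g k else 0)"
      using x by (intro sum.cong) (auto simp: indicator_def)
    then show "g (Z x) = (\<Sum>k\<le>m. indicator (Z -` {k} \<inter> space M) x * g k)" using m[OF x] by simp
  qed
  also have "\<dots> = (\<Sum>k\<le>m. \<integral>x. indicator (Z -` {k} \<inter> space M) x * g k \<partial>M)"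
    by (rule Bochner_Integration.integral_sum) (auto intro!: integrable_real_mult_indicator sets simp: emeasure_eq_measure)
  finally show ?thesis by simp
qed

text \<open>Tensorization is applied to \<open>exp (l Z)\<close> with comparison functions
  \<open>exp (l Z' i)\<close>. A coordinate contributes only where deleting it lowers
  \<open>Z\<close>, and there are at most \<open>Z\<close> such coordinates. This yields
  \<open>l F' - F ln F \<le> (l - 1 + exp (- l)) F'\<close> for the moment generating function
  \<open>F\<close>, which rearranges to the differential inequality solved above.\<close>

theorem self_bounding_mgf:
  fixes M :: "'a measure" and I :: "'i set" and Z :: "('i \<Rightarrow> 'a) \<Rightarrow> nat"
    and Z' :: "'i \<Rightarrow> ('i \<Rightarrow> 'a) \<Rightarrow> nat" and l :: real
  defines "P \<equiv> PiM I (\<lambda>_. M)"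
  assumes M: "prob_space M" and I: "finite I"
    and Z: "Z \<in> measurable P (count_space UNIV)"
    and Z': "\<And>i. i \<in> I \<Longrightarrow> Z' i \<in> measurable P (count_space UNIV)"
    and inv: "\<And>i. i \<in> I \<Longrightarrow> coord_invariant M I i (Z' i)"
    and m: "\<And>x. x \<in> space P \<Longrightarrow> Z x \<le> m"
    and diff: "\<And>i x. i \<in> I \<Longrightarrow> x \<in> space P \<Longrightarrow> Z' i x \<le> Z x \<and> Z x \<le> Z' i x + 1"
    and self: "\<And>x. x \<in> space P \<Longrightarrow> (\<Sum>i\<in>I. Z x - Z' i x) \<le> Z x"
  shows "(\<integral>x. exp (l * real (Z x)) \<partial>P) \<le> exp ((exp l - 1) * (\<integral>x. real (Z x) \<partial>P))"
proof -
  interpret P: prob_space P unfolding P_def by (rule prob_space_PiM) (rule M)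
  define p where "p k = P.prob (Z -` {k} \<inter> space P)" for k
  define F where "F l = (\<Sum>k\<le>m. p k * exp (l * real k))" for l
  define F' where "F' l = (\<Sum>k\<le>m. p k * (real k * exp (l * real k)))" for l
  have EZ: "(\<integral>x. g (Z x) \<partial>P) = (\<Sum>k\<le>m. p k * g k)" for g :: "nat \<Rightarrow> real"
    unfolding p_def by (rule P.expectation_of_bounded_nat[OF Z m])
  have EF: "(\<integral>x. exp (l * real (Z x)) \<partial>P) = F l" for l
    unfolding F_def by (rule EZ)
  have EF': "(\<integral>x. real (Z x) * exp (l * real (Z x)) \<partial>P) = F' l" for l
    unfolding F'_def by (rule EZ)
  have intZ: "integrable P (\<lambda>x. g (Z x))" for g :: "nat \<Rightarrow> real"
  proof (rule measurable_bounded_integrable[OF P.prob_space_axioms])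
    show "(\<lambda>x. g (Z x)) \<in> borel_measurable P" by (rule measurable_compose[OF Z]) simp
    show "Min (g ` {..m}) \<le> g (Z x) \<and> g (Z x) \<le> Max (g ` {..m})" if "x \<in> space P" for x
      using m[OF that] by auto
  qed
  have pos: "0 < F l" for l
  proof -
    have "exp (- \<bar>l\<bar> * m) \<le> (\<integral>x. exp (l * real (Z x)) \<partial>P)"
    proof (rule P.integral_ge_const[OF intZ], rule AE_I2)
      fix x assume x: "x \<in> space P"
      have "\<bar>l * real (Z x)\<bar> \<le> \<bar>l\<bar> * m" unfolding abs_mult using m[OF x] by (auto intro: mult_left_mono)
      then show "exp (- \<bar>l\<bar> * m) \<le> exp (l * real (Z x))" by simp
    qed
    then show ?thesis unfolding EF using less_le_trans[OF exp_gt_zero] by blast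
  qed
  have ineq: "(1 - exp (- l)) * F' l \<le> F l * ln (F l)" for l
  proof -
    \<comment> \<open>The value of \<open>f ln (f / c) - f + c\<close> for
      \<open>f = exp (l Z)\<close> and \<open>c = exp (l (Z - 1))\<close>, divided by
      \<open>f\<close>.\<close>
    define \<phi> where "\<phi> = l - 1 + exp (- l)"
    have \<phi>: "0 \<le> \<phi>" using exp_ge_add_one_self[of "- l"] by (simp add: \<phi>_def)
    have eb: "exp (- \<bar>l\<bar> * m) \<le> exp (l * real k) \<and> exp (l * real k) \<le> exp (\<bar>l\<bar> * m)" if "k \<le> m" for k
    proof -
      have "\<bar>l * real k\<bar> \<le> \<bar>l\<bar> * m" unfolding abs_mult using that by (auto intro: mult_left_mono)
      then show ?thesis by (auto simp: abs_le_iff)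
    qed
    have "(\<integral>x. exp (l * real (Z x)) * ln (exp (l * real (Z x))) \<partial>P)
         - (\<integral>x. exp (l * real (Z x)) \<partial>P) * ln (\<integral>x. exp (l * real (Z x)) \<partial>P)
      \<le> (\<Sum>i\<in>I. \<integral>x. exp (l * real (Z x)) * ln (exp (l * real (Z x)) / exp (l * real (Z' i x)))
            - exp (l * real (Z x)) + exp (l * real (Z' i x)) \<partial>P)"
    proof (rule entropy_tensorization[OF M I, folded P_def])
      show "0 < exp (- \<bar>l\<bar> * m)" by simp
      show "(\<lambda>x. exp (l * real (Z x))) \<in> borel_measurable P" by (rule measurable_compose[OF Z]) simp
      show "exp (- \<bar>l\<bar> * m) \<le> exp (l * real (Z x)) \<and> exp (l * real (Z x)) \<le> exp (\<bar>l\<bar> * m)"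
        if "x \<in> space P" for x using eb m[OF that] by blast
      fix i assume i: "i \<in> I"
      show "(\<lambda>x. exp (l * real (Z' i x))) \<in> borel_measurable P" by (rule measurable_compose[OF Z'[OF i]]) simp
      show "exp (- \<bar>l\<bar> * m) \<le> exp (l * real (Z' i x)) \<and> exp (l * real (Z' i x)) \<le> exp (\<bar>l\<bar> * m)"
        if "x \<in> space P" for x using eb[of "Z' i x"] m[OF that] diff[OF i that] by force
      show "coord_invariant M I i (\<lambda>x. exp (l * real (Z' i x)))"
        using inv[OF i] by (simp add: coord_invariant_def)
    qed
    also have "\<dots> = (\<Sum>i\<in>I. \<integral>x. exp (l * real (Z x)) * \<phi> * real (Z x - Z' i x) \<partial>P)"
    proof (intro sum.cong refl Bochner_Integration.integral_cong)
      fix i x assume i: "i \<in> I" and x: "x \<in> space P"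
      have "Z' i x = Z x \<or> Z x = Z' i x + 1" using diff[OF i x] by auto
      then show "exp (l * real (Z x)) * ln (exp (l * real (Z x)) / exp (l * real (Z' i x)))
            - exp (l * real (Z x)) + exp (l * real (Z' i x)) = exp (l * real (Z x)) * \<phi> * real (Z x - Z' i x)"
        by (auto simp: \<phi>_def algebra_simps ln_div exp_add[symmetric] simp flip: exp_diff)
    qed
    also have "\<dots> = (\<integral>x. (\<Sum>i\<in>I. exp (l * real (Z x)) * \<phi> * real (Z x - Z' i x)) \<partial>P)"
    proof (rule Bochner_Integration.integral_sum[symmetric])
      fix i assume i: "i \<in> I"
      have [measurable]: "Z \<in> measurable P (count_space UNIV)" "Z' i \<in> measurable P (count_space UNIV)"
        using Z Z'[OF i] by auto
      show "integrable P (\<lambda>x. exp (l * real (Z x)) * \<phi> * real (Z x - Z' i x))"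
      proof (rule Bochner_Integration.integrable_bound[OF intZ[of "\<lambda>k. exp (l * real k) * \<phi>"]])
        show "(\<lambda>x. exp (l * real (Z x)) * \<phi> * real (Z x - Z' i x)) \<in> borel_measurable P" by measurable
        show "AE x in P. norm (exp (l * real (Z x)) * \<phi> * real (Z x - Z' i x)) \<le> norm (exp (l * real (Z x)) * \<phi>)"
          using \<phi> diff[OF i] by (intro AE_I2) (force simp: abs_mult intro!: mult_left_le)
      qed
    qed
    also have "\<dots> \<le> (\<integral>x. \<phi> * (real (Z x) * exp (l * real (Z x))) \<partial>P)"
    proof (rule integral_mono')
      show "integrable P (\<lambda>x. \<phi> * (real (Z x) * exp (l * real (Z x))))"
        by (rule intZ[of "\<lambda>k. \<phi> * (real k * exp (l * real k))"])
      fix x assume x: "x \<in> space P"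
      have "(\<Sum>i\<in>I. exp (l * real (Z x)) * \<phi> * real (Z x - Z' i x)) = exp (l * real (Z x)) * \<phi> * real (\<Sum>i\<in>I. Z x - Z' i x)"
        by (simp add: sum_distrib_left)
      also have "\<dots> \<le> exp (l * real (Z x)) * \<phi> * real (Z x)"
        using \<phi> self[OF x] by (intro mult_left_mono) (auto simp del: of_nat_sum)
      finally show "(\<Sum>i\<in>I. exp (l * real (Z x)) * \<phi> * real (Z x - Z' i x)) \<le> \<phi> * (real (Z x) * exp (l * real (Z x)))"
        by (simp add: mult_ac)
    qed (use \<phi> in auto)
    also have "\<dots> = \<phi> * F' l" by (simp add: EF')
    also have "(\<integral>x. exp (l * real (Z x)) * ln (exp (l * real (Z x))) \<partial>P) = l * F' l"
      unfolding EF'[symmetric] by (subst integral_mult_right_zero[symmetric]) (simp add: mult_ac)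
    finally show ?thesis unfolding EF \<phi>_def by (simp add: algebra_simps)
  qed
  have "(F has_real_derivative F' t) (at t)" for t
    unfolding F_def[abs_def] F'_def by (auto intro!: derivative_eq_intros sum.cong simp: mult_ac)
  moreover have "F 0 = 1" using EF[of 0] by (simp add: P.prob_space)
  ultimately have "ln (F l) \<le> (exp l - 1) * F' 0"
    using mgf_differential_inequality[of F F' l] pos ineq by blast
  moreover have "F' 0 = (\<integral>x. real (Z x) \<partial>P)" using EF'[of 0] by simp
  ultimately show ?thesis unfolding EF using pos[of l] by (metis exp_ln exp_le_cancel_iff)
qed

section \<open>Convex chains\<close>

text \<open>All extreme points of the hull lie among the generators \<open>S\<close>, and
  \<open>S\<close> has at most \<open>card Y + 2\<close> elements. The prescribed number of vertices
  is therefore attained exactly when the generators are distinct and all of them are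
  extreme.\<close>

lemma convex_chain_iff:
  "convex_chain p0 p1 p2 Y \<longleftrightarrow>
     finite Y \<and> Y \<subseteq> triangle_hull p0 p1 p2 \<and> p0 \<noteq> p2 \<and> p0 \<notin> Y \<and> p2 \<notin> Y \<and>
     (\<forall>x\<in>insert p0 (insert p2 Y). x \<notin> convex hull (insert p0 (insert p2 Y) - {x}))"
proof (cases "finite Y")
  case False then show ?thesis by (simp add: convex_chain_def)
next
  case fin: True
  define S where "S = insert p0 (insert p2 Y)"
  define E where "E = {v. v extreme_point_of (convex hull S)}"
  have finS: "finite S" using fin by (simp add: S_def)
  have S': "Y \<union> {p0, p2} = S" by (auto simp: S_def)
  have ES: "E \<subseteq> S" unfolding E_def using extreme_point_of_convex_hull by blast
  have cardS: "card S = card Y + 2 \<longleftrightarrow> p0 \<noteq> p2 \<and> p0 \<notin> Y \<and> p2 \<notin> Y"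
    using fin by (auto simp: S_def card_insert_if)
  have cardle: "card S \<le> card Y + 2"
    using fin by (auto simp: S_def card_insert_if)
  have cE: "card E = card Y + 2 \<longleftrightarrow> E = S \<and> card S = card Y + 2"
    using card_mono[OF finS ES] card_subset_eq[OF finS ES] cardle by auto
  have ext: "x extreme_point_of (convex hull S) \<longleftrightarrow> x \<notin> convex hull (S - {x})" if x: "x \<in> S" for x
  proof
    assume "x extreme_point_of (convex hull S)"
    then have "convex (convex hull S - {x})" by (simp add: extreme_point_of_stillconvex)
    then have "convex hull (S - {x}) \<subseteq> convex hull S - {x}"
      by (intro hull_minimal) (auto simp: hull_inc)
    then show "x \<notin> convex hull (S - {x})" by auto
  next
    assume "x \<notin> convex hull (S - {x})"
    then have "x extreme_point_of (convex hull (insert x (S - {x})))"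
      using finS by (intro extreme_point_of_convex_hull_insert) auto
    then show "x extreme_point_of (convex hull S)" using x by (simp add: insert_absorb)
  qed
  have "E = S \<longleftrightarrow> (\<forall>x\<in>S. x \<notin> convex hull (S - {x}))"
    using ES ext by (auto simp: E_def)
  moreover have "polytope (convex hull S)" using finS by (simp add: polytope_convex_hull)
  ultimately show ?thesis
    unfolding convex_chain_def convex_polygon_def S' E_def[symmetric] cE cardS
    using fin by (auto simp: S_def)
qed

lemma convex_chain_subset:
  assumes "convex_chain p0 p1 p2 Y" "Y' \<subseteq> Y"
  shows "convex_chain p0 p1 p2 Y'"
proof -
  have "x \<notin> convex hull (insert p0 (insert p2 Y') - {x})" if "x \<in> insert p0 (insert p2 Y')" for x
  proof -
    have "x \<notin> convex hull (insert p0 (insert p2 Y) - {x})"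
      using assms that unfolding convex_chain_iff by blast
    moreover have "convex hull (insert p0 (insert p2 Y') - {x}) \<subseteq> convex hull (insert p0 (insert p2 Y) - {x})"
      using assms(2) by (intro hull_mono) auto
    ultimately show ?thesis by auto
  qed
  then show ?thesis using assms unfolding convex_chain_iff by (auto intro: finite_subset)
qed

lemma convex_chain_empty: "p0 \<noteq> p2 \<Longrightarrow> convex_chain p0 p1 p2 {}"
  unfolding convex_chain_iff by (auto simp: insert_Diff_if)

context
  fixes p0 p1 p2 :: "real ^ 2"
  assumes p02: "p0 \<noteq> p2"
begin

text \<open>Since \<open>p0 \<noteq> p2\<close>, the empty set is a chain, so the maximum is taken
  over a nonempty set.\<close>

lemma longest_chain_witness:
  assumes "finite X"
  shows "\<exists>Y\<subseteq>X. convex_chain p0 p1 p2 Y \<and> card Y = longest_chain p0 p1 p2 X"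
proof -
  have "finite {card Y |Y. Y \<subseteq> X \<and> convex_chain p0 p1 p2 Y}"
    by (rule finite_subset[of _ "card ` Pow X"]) (use assms in auto)
  moreover have "{card Y |Y. Y \<subseteq> X \<and> convex_chain p0 p1 p2 Y} \<noteq> {}"
    using convex_chain_empty[OF p02] by blast
  ultimately have "longest_chain p0 p1 p2 X \<in> {card Y |Y. Y \<subseteq> X \<and> convex_chain p0 p1 p2 Y}"
    unfolding longest_chain_def by (rule Max_in)
  then show ?thesis by auto
qed

lemma longest_chain_ge:
  assumes "finite X" "Y \<subseteq> X" "convex_chain p0 p1 p2 Y"
  shows "card Y \<le> longest_chain p0 p1 p2 X"
  unfolding longest_chain_def
  by (rule Max_ge) (use assms in \<open>auto intro: finite_subset[of _ "card ` Pow X"]\<close>)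

lemma longest_chain_mono:
  assumes "finite X'" "X \<subseteq> X'"
  shows "longest_chain p0 p1 p2 X \<le> longest_chain p0 p1 p2 X'"
proof -
  have "finite X" using assms finite_subset by auto
  from longest_chain_witness[OF this] obtain Y where "Y \<subseteq> X" "convex_chain p0 p1 p2 Y"
    "card Y = longest_chain p0 p1 p2 X" by blast
  then show ?thesis using longest_chain_ge[OF assms(1), of Y] assms by auto
qed

text \<open>Passes from sets of points to sets of indices; sample points may coincide, and
  injectivity on \<open>J\<close> keeps the count right. Subsets of chains are chains, so exactly
  \<open>k\<close> indices can be demanded. The event becomes a finite union over index sets, the
  form used for measurability, for self-bounding and for the union bound.\<close>

lemma longest_chain_le_iff:
  assumes "finite I"
  shows "k \<le> longest_chain p0 p1 p2 (x ` I) \<longleftrightarrow>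
    (\<exists>J\<subseteq>I. card J = k \<and> inj_on x J \<and> convex_chain p0 p1 p2 (x ` J))"
proof
  assume k: "k \<le> longest_chain p0 p1 p2 (x ` I)"
  from longest_chain_witness[of "x ` I"] assms obtain Y where Y: "Y \<subseteq> x ` I" "convex_chain p0 p1 p2 Y"
    "card Y = longest_chain p0 p1 p2 (x ` I)" by auto
  from k Y(3) obtain Y' where Y': "Y' \<subseteq> Y" "card Y' = k" "finite Y'"
    by (metis obtain_subset_with_card_n)
  obtain J where J: "J \<subseteq> I" "inj_on x J" "Y' = x ` J"
    using subset_image_inj[of Y' x I] Y' Y(1) by auto
  then show "\<exists>J\<subseteq>I. card J = k \<and> inj_on x J \<and> convex_chain p0 p1 p2 (x ` J)"
    using convex_chain_subset[OF Y(2) Y'(1)] Y'(2) by (auto simp: card_image)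
next
  assume "\<exists>J\<subseteq>I. card J = k \<and> inj_on x J \<and> convex_chain p0 p1 p2 (x ` J)"
  then show "k \<le> longest_chain p0 p1 p2 (x ` I)"
    using longest_chain_ge[of "x ` I"] assms by (metis card_image finite_imageI image_mono)
qed

lemma longest_chain_le_card:
  assumes "finite I" shows "longest_chain p0 p1 p2 (x ` I) \<le> card I"
  using longest_chain_le_iff[of I "longest_chain p0 p1 p2 (x ` I)" x] assms by (metis card_mono order_refl)

lemma longest_chain_remove:
  assumes "finite I"
  shows "longest_chain p0 p1 p2 (x ` I) \<le> longest_chain p0 p1 p2 (x ` (I - {i})) + 1"
proof -
  obtain J where J: "J \<subseteq> I" "card J = longest_chain p0 p1 p2 (x ` I)" "inj_on x J" "convex_chain p0 p1 p2 (x ` J)"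
    using longest_chain_le_iff[of I "longest_chain p0 p1 p2 (x ` I)" x] assms by auto
  have "card (J - {i}) \<le> longest_chain p0 p1 p2 (x ` (I - {i}))"
    using longest_chain_le_iff[of "I - {i}" "card (J - {i})" x] assms J
      convex_chain_subset[OF J(4), of "x ` (J - {i})"] by (auto intro!: exI[of _ "J - {i}"] intro: inj_on_subset)
  moreover have "card J \<le> card (J - {i}) + 1"
    by (auto simp: card_Diff_singleton_if)
  ultimately show ?thesis using J(2) by linarith
qed

lemma longest_chain_self_bounding:
  assumes "finite I"
  shows "(\<Sum>i\<in>I. longest_chain p0 p1 p2 (x ` I) - longest_chain p0 p1 p2 (x ` (I - {i})))
    \<le> longest_chain p0 p1 p2 (x ` I)"
proof -
  let ?L = "longest_chain p0 p1 p2"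
  obtain J where J: "J \<subseteq> I" "card J = ?L (x ` I)" "inj_on x J" "convex_chain p0 p1 p2 (x ` J)"
    using longest_chain_le_iff[of I "?L (x ` I)" x] assms by auto
  have "?L (x ` I) - ?L (x ` (I - {i})) \<le> (if i \<in> J then 1 else 0)" for i
  proof (cases "i \<in> J")
    case True then show ?thesis using longest_chain_remove[OF assms, of x i] by simp
  next
    case False
    then have "J \<subseteq> I - {i}" using J(1) by auto
    then have "card J \<le> ?L (x ` (I - {i}))"
      using longest_chain_le_iff[of "I - {i}" "card J" x] assms J by auto
    then show ?thesis using J(2) False by simp
  qed
  then have "(\<Sum>i\<in>I. ?L (x ` I) - ?L (x ` (I - {i}))) \<le> (\<Sum>i\<in>I. if i \<in> J then 1 else 0)"
    by (rule sum_mono)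
  also have "\<dots> = card J" using assms J(1) by (simp add: sum.If_cases Int_absorb1)
  finally show ?thesis using J(2) by simp
qed

end

text \<open>Strict separation is an open condition on the normal vector, so normals from a countable
  dense set suffice; this makes the event of forming a chain measurable.\<close>

lemma not_in_convex_hull_iff_dense_normal:
  fixes z :: "'a :: euclidean_space"
  assumes S: "finite S" and D: "\<And>X. open X \<Longrightarrow> X \<noteq> {} \<Longrightarrow> \<exists>d\<in>D. d \<in> X"
  shows "z \<notin> convex hull S \<longleftrightarrow> (\<exists>w\<in>D. \<forall>s\<in>S. w \<bullet> z < w \<bullet> s)"
proof
  assume "z \<notin> convex hull S"
  moreover have "closed (convex hull S)"
    using S by (intro compact_imp_closed finite_imp_compact_convex_hull)
  ultimately obtain a b where ab: "a \<bullet> z < b" "\<forall>x\<in>convex hull S. a \<bullet> x > b"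
    using separating_hyperplane_closed_point[of "convex hull S" z] by auto
  let ?X = "\<Inter>s\<in>S. {w. w \<bullet> z < w \<bullet> s}"
  have "open ?X" using S by (intro open_INT) (auto intro!: open_Collect_less continuous_intros)
  moreover have "a \<in> ?X"
  proof (rule INT_I)
    fix s assume "s \<in> S"
    then have "b < a \<bullet> s" using ab(2) by (simp add: hull_inc)
    then show "a \<in> {w. w \<bullet> z < w \<bullet> s}" using ab(1) by simp
  qed
  ultimately show "\<exists>w\<in>D. \<forall>s\<in>S. w \<bullet> z < w \<bullet> s" using D[of ?X] by auto
next
  assume "\<exists>w\<in>D. \<forall>s\<in>S. w \<bullet> z < w \<bullet> s"
  then obtain w where "S \<subseteq> {s. w \<bullet> s > w \<bullet> z}" by auto
  then have "convex hull S \<subseteq> {s. w \<bullet> s > w \<bullet> z}" by (rule hull_minimal) (rule convex_halfspace_gt)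
  then show "z \<notin> convex hull S" by auto
qed

text \<open>Removing a point by value is replaced by removing an index, so that every condition is
  about the hull of a fixed finite family of random points, to which the separation criterion
  applies. Injectivity is implied by these conditions: a repeated point would lie in the hull of the
  others.\<close>

lemma inj_convex_chain_image_iff:
  assumes "finite J"
  shows "inj_on x J \<and> convex_chain p0 p1 p2 (x ` J) \<longleftrightarrow>
    p0 \<notin> convex hull (insert p2 (x ` J)) \<and> p2 \<notin> convex hull (insert p0 (x ` J)) \<and>
    (\<forall>j\<in>J. x j \<in> triangle_hull p0 p1 p2 \<and> x j \<notin> convex hull (insert p0 (insert p2 (x ` (J - {j})))))"
    (is "?l \<longleftrightarrow> ?r")
proof
  assume l: ?l
  have 1: "insert p0 (insert p2 (x ` J)) - {p0} = insert p2 (x ` J)"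
    "insert p0 (insert p2 (x ` J)) - {p2} = insert p0 (x ` J)"
    using l unfolding convex_chain_iff by auto
  have 2: "insert p0 (insert p2 (x ` J)) - {x j} = insert p0 (insert p2 (x ` (J - {j})))" if "j \<in> J" for j
    using l that unfolding convex_chain_iff by (auto simp: inj_on_def)
  show ?r using l 1 2 unfolding convex_chain_iff by auto
next
  assume r: ?r
  have inj: "inj_on x J"
  proof (rule inj_onI, rule ccontr)
    fix i j assume ij: "i \<in> J" "j \<in> J" "x i = x j" "i \<noteq> j"
    then have "x i \<in> convex hull (insert p0 (insert p2 (x ` (J - {i}))))" by (intro hull_inc) auto
    then show False using r ij by auto
  qed
  have ne: "p0 \<noteq> p2" "p0 \<notin> x ` J" "p2 \<notin> x ` J" using r hull_inc[of p0 "insert p2 (x ` J)" convex] hull_inc[of p2 "insert p0 (x ` J)" convex] by auto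
  have 1: "insert p0 (insert p2 (x ` J)) - {p0} = insert p2 (x ` J)"
    "insert p0 (insert p2 (x ` J)) - {p2} = insert p0 (x ` J)"
    using ne by auto
  have 2: "insert p0 (insert p2 (x ` J)) - {x j} = insert p0 (insert p2 (x ` (J - {j})))" if "j \<in> J" for j
    using ne inj that by (auto simp: inj_on_def)
  show ?l using r inj ne 1 2 assms unfolding convex_chain_iff by auto
qed

lemma compact_triangle_hull: "compact (triangle_hull p0 p1 p2)"
  unfolding triangle_hull_def by (rule finite_imp_compact_convex_hull) simp

lemma pred_inj_convex_chain:
  fixes U :: "(real ^ 2) measure"
  assumes U: "sets U = sets borel" and J: "finite J" "J \<subseteq> I"
  shows "Measurable.pred (PiM I (\<lambda>_. U)) (\<lambda>x. inj_on x J \<and> convex_chain p0 p1 p2 (x ` J))"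
proof -
  obtain D :: "(real ^ 2) set" where D: "countable D" "\<And>X. open X \<Longrightarrow> X \<noteq> {} \<Longrightarrow> \<exists>d\<in>D. d \<in> X"
    using countable_dense_exists by blast
  note nh = not_in_convex_hull_iff_dense_normal[OF _ D(2)]
  have [measurable]: "(\<lambda>x. x j) \<in> borel_measurable (PiM I (\<lambda>_. U))" if "j \<in> J" for j
  proof -
    have "(\<lambda>x. x j) \<in> measurable (PiM I (\<lambda>_. U)) U"
      by (rule measurable_component_singleton) (use that J in auto)
    then show ?thesis using measurable_cong_sets[OF refl U] by blast
  qed
  have [measurable]: "triangle_hull p0 p1 p2 \<in> sets borel"
    using compact_triangle_hull by (simp add: borel_compact)
  note [measurable] = J(1) D(1)
  have [measurable]: "finite (J - {j})" for j using J by auto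
  show ?thesis
    unfolding inj_convex_chain_image_iff[OF J(1)] using J(1)
    by (simp add: nh cong: conj_cong)
qed

lemma measurable_longest_chain:
  fixes U :: "(real ^ 2) measure"
  assumes U: "sets U = sets borel" and J: "finite J" "J \<subseteq> I" and p02: "p0 \<noteq> p2"
  shows "(\<lambda>x. longest_chain p0 p1 p2 (x ` J)) \<in> measurable (PiM I (\<lambda>_. U)) (count_space UNIV)"
proof -
  have [measurable]: "Measurable.pred (PiM I (\<lambda>_. U)) (\<lambda>x. k \<le> longest_chain p0 p1 p2 (x ` J))" for k
  proof -
    have "finite {K. K \<subseteq> J \<and> card K = k}" using J by auto
    then have "Measurable.pred (PiM I (\<lambda>_. U))
      (\<lambda>x. \<exists>K\<in>{K. K \<subseteq> J \<and> card K = k}. inj_on x K \<and> convex_chain p0 p1 p2 (x ` K))"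
      by (rule pred_intros_finite) (use J in \<open>auto intro!: pred_inj_convex_chain[OF U] intro: finite_subset\<close>)
    then show ?thesis unfolding longest_chain_le_iff[OF p02 J(1)] by (simp add: conj_assoc)
  qed
  have "(\<lambda>x. longest_chain p0 p1 p2 (x ` J) = k)
      = (\<lambda>x. k \<le> longest_chain p0 p1 p2 (x ` J) \<and> \<not> Suc k \<le> longest_chain p0 p1 p2 (x ` J))" for k
    by auto
  then have "Measurable.pred (PiM I (\<lambda>_. U)) (\<lambda>x. longest_chain p0 p1 p2 (x ` J) = k)" for k
    by simp
  then show ?thesis
    by (subst measurable_count_space_eq2_countable) (auto simp: pred_def vimage_def Int_def conj_commute)
qed

section \<open>The steps of a convex chain\<close>

text \<open>Cramer's rule for the basis dual to the edges \<open>p1 - p0\<close> and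
  \<open>p2 - p1\<close>. \<open>D\<close> is their determinant, which vanishes only for parallel
  edges.\<close>

lemma triangle_dual_basis:
  fixes p0 p1 p2 :: "real ^ 2"
  assumes "\<not> collinear {p0, p1, p2}"
  shows "\<exists>a b. a \<bullet> (p1 - p0) = 1 \<and> a \<bullet> (p2 - p1) = 0 \<and> b \<bullet> (p1 - p0) = 0 \<and> b \<bullet> (p2 - p1) = 1 \<and>
     (\<forall>w. w = (a \<bullet> w) *\<^sub>R (p1 - p0) + (b \<bullet> w) *\<^sub>R (p2 - p1))"
proof -
  define e f where "e = p1 - p0" and "f = p2 - p1"
  define D where "D = e $ 1 * f $ 2 - e $ 2 * f $ 1"
  have D: "D \<noteq> 0"
  proof
    assume D: "D = 0"
    have "collinear {0, p0 - p1, p2 - p1}"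
    proof (cases "e = 0")
      case True then show ?thesis by (simp add: e_def collinear_lemma)
    next
      case False
      then have "e $ 1 \<noteq> 0 \<or> e $ 2 \<noteq> 0" by (auto simp: vec_eq_iff forall_2)
      then have "\<exists>c. f = c *\<^sub>R e"
      proof
        assume "e $ 1 \<noteq> 0"
        then show ?thesis using D
          by (intro exI[of _ "f $ 1 / e $ 1"]) (auto simp: vec_eq_iff forall_2 D_def field_simps)
      next
        assume "e $ 2 \<noteq> 0"
        then show ?thesis using D
          by (intro exI[of _ "f $ 2 / e $ 2"]) (auto simp: vec_eq_iff forall_2 D_def field_simps)
      qed
      then obtain c where "f = c *\<^sub>R e" by blast
      then have "p2 - p1 = (- c) *\<^sub>R (p0 - p1)" by (simp add: e_def f_def algebra_simps)
      then show ?thesis unfolding collinear_lemma by blast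
    qed
    then show False using assms collinear_3[of p0 p1 p2] by simp
  qed
  define a b :: "real ^ 2" where "a = vector [f $ 2 / D, - (f $ 1 / D)]" and "b = vector [- (e $ 2 / D), e $ 1 / D]"
  have ip: "a \<bullet> w = (f $ 2 * w $ 1 - f $ 1 * w $ 2) / D" "b \<bullet> w = (e $ 1 * w $ 2 - e $ 2 * w $ 1) / D" for w
    by (simp_all add: a_def b_def inner_vec_def sum_2 diff_divide_distrib algebra_simps)
  have "w = (a \<bullet> w) *\<^sub>R e + (b \<bullet> w) *\<^sub>R f" for w
    unfolding vec_eq_iff forall_2 ip using D
    by (simp add: field_simps) (simp add: D_def algebra_simps)
  moreover have "a \<bullet> e = 1" "a \<bullet> f = 0" "b \<bullet> e = 0" "b \<bullet> f = 1"
    unfolding ip using D by (simp_all add: D_def algebra_simps)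
  ultimately show ?thesis unfolding e_def f_def by blast
qed

text \<open>The affine coordinates are kept as two functionals and not as a change of variables. All
  measures thus stay on the original plane, and the area of the triangle cancels in the end.\<close>

locale triangle_coords =
  fixes p0 p1 p2 a b :: "real ^ 2"
  assumes dual: "a \<bullet> (p1 - p0) = 1" "a \<bullet> (p2 - p1) = 0" "b \<bullet> (p1 - p0) = 0" "b \<bullet> (p2 - p1) = 1"
    and repr: "\<And>w. w = (a \<bullet> w) *\<^sub>R (p1 - p0) + (b \<bullet> w) *\<^sub>R (p2 - p1)"
begin

abbreviation "T \<equiv> triangle_hull p0 p1 p2"

lemma dual_p2: "a \<bullet> (p2 - p0) = 1" "b \<bullet> (p2 - p0) = 1"
  using dual by (simp_all add: inner_diff_right)

lemma coords_eqI: "a \<bullet> w = a \<bullet> z \<Longrightarrow> b \<bullet> w = b \<bullet> z \<Longrightarrow> w = z"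
  by (metis repr)

text \<open>If \<open>u\<close> and \<open>v\<close> are the coordinates of \<open>q - p0\<close>,
  the barycentric coordinates of \<open>q\<close> are \<open>1 - u\<close>, \<open>u - v\<close> and
  \<open>v\<close>; the three inequalities state that they are nonnegative.\<close>

lemma triangle_iff: "q \<in> T \<longleftrightarrow> 0 \<le> b \<bullet> (q - p0) \<and> b \<bullet> (q - p0) \<le> a \<bullet> (q - p0) \<and> a \<bullet> (q - p0) \<le> 1"
proof
  assume "q \<in> T"
  then obtain s t r where str: "0 \<le> s" "0 \<le> t" "0 \<le> r" "s + t + r = 1" "q = s *\<^sub>R p0 + t *\<^sub>R p1 + r *\<^sub>R p2"
    unfolding triangle_hull_def convex_hull_3 by auto
  have s: "s = 1 - t - r" using str(4) by simp
  have "q - p0 = (t + r) *\<^sub>R (p1 - p0) + r *\<^sub>R (p2 - p1)"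
    using str(5) unfolding s by (simp add: algebra_simps)
  then have "a \<bullet> (q - p0) = t + r" "b \<bullet> (q - p0) = r"
    using dual by (simp_all add: inner_add_right)
  then show "0 \<le> b \<bullet> (q - p0) \<and> b \<bullet> (q - p0) \<le> a \<bullet> (q - p0) \<and> a \<bullet> (q - p0) \<le> 1"
    using str by auto
next
  define u v where "u = a \<bullet> (q - p0)" and "v = b \<bullet> (q - p0)"
  assume "0 \<le> b \<bullet> (q - p0) \<and> b \<bullet> (q - p0) \<le> a \<bullet> (q - p0) \<and> a \<bullet> (q - p0) \<le> 1"
  then have uv: "0 \<le> v" "v \<le> u" "u \<le> 1" by (auto simp: u_def v_def)
  have "q - p0 = u *\<^sub>R (p1 - p0) + v *\<^sub>R (p2 - p1)"
    unfolding u_def v_def by (rule repr)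
  then have "q = (1 - u) *\<^sub>R p0 + (u - v) *\<^sub>R p1 + v *\<^sub>R p2"
    by (simp add: algebra_simps)
  then show "q \<in> T" unfolding triangle_hull_def convex_hull_3 using uv
    by (intro CollectI exI[of _ "1 - u"] exI[of _ "u - v"] exI[of _ v]) auto
qed

text \<open>The slope \<open>s = b / a\<close> in the form \<open>s / (1 + s)\<close>: increasing in
  \<open>s\<close>, and still finite for vertical steps.\<close>

definition step_slope :: "real ^ 2 \<Rightarrow> real" where
  "step_slope w = b \<bullet> w / (a \<bullet> w + b \<bullet> w)"

text \<open>A relaxation of what a chain provides, reduced to what the volume estimate uses. The
  total displacement has both coordinates at most 1; only the sum of these two bounds is kept,
  because the exponential weight depends on \<open>a + b\<close> alone.\<close>

definition convex_steps :: "nat \<Rightarrow> (nat \<Rightarrow> real ^ 2) \<Rightarrow> bool" where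
  "convex_steps k w \<longleftrightarrow> (\<forall>i<k. 0 \<le> a \<bullet> w i \<and> 0 \<le> b \<bullet> w i) \<and>
     (\<forall>i<k. \<forall>j<k. i < j \<longrightarrow> step_slope (w i) < step_slope (w j)) \<and>
     (\<Sum>i<k. a \<bullet> w i + b \<bullet> w i) \<le> 2"

definition steps :: "(nat \<Rightarrow> real ^ 2) \<Rightarrow> nat \<Rightarrow> real ^ 2" where
  "steps q i = q i - (if i = 0 then p0 else q (i - 1))"

section \<open>Angular order and turns along a chain\<close>

lemma step_slope_less:
  assumes "0 \<le> a \<bullet> w" "0 \<le> b \<bullet> w" "0 \<le> a \<bullet> z" "0 \<le> b \<bullet> z"
    and "0 < (a \<bullet> w) * (b \<bullet> z) - (b \<bullet> w) * (a \<bullet> z)"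
  shows "step_slope w < step_slope z"
proof -
  have "0 < (a \<bullet> w) * (b \<bullet> z)" using assms mult_nonneg_nonneg[of "b \<bullet> w" "a \<bullet> z"] by linarith
  then have "0 < a \<bullet> w" "0 < b \<bullet> z" using assms by (auto simp: zero_less_mult_iff)
  then show ?thesis using assms unfolding step_slope_def
    by (subst divide_less_eq) (auto simp: field_simps add_pos_nonneg add_nonneg_pos)
qed

text \<open>Twice the signed area of the triangle \<open>p0 x y\<close> in the affine coordinates,
  positive when \<open>y\<close> has the larger angle at \<open>p0\<close>.\<close>

definition orient :: "real ^ 2 \<Rightarrow> real ^ 2 \<Rightarrow> real" where
  "orient x y = (a \<bullet> (x - p0)) * (b \<bullet> (y - p0)) - (b \<bullet> (x - p0)) * (a \<bullet> (y - p0))"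

text \<open>The point \<open>y\<close> lies in the angle \<open>x p0 z\<close>; unless it is beyond the line through \<open>x\<close> and
  \<open>z\<close>, it belongs to the triangle \<open>p0 x z\<close> and is not a vertex.\<close>

lemma chain_turn:
  assumes Y: "convex_chain p0 p1 p2 Y"
    and xyz: "x \<in> insert p2 Y" "y \<in> Y" "z \<in> insert p2 Y" "x \<noteq> y" "z \<noteq> y"
    and pos: "0 < orient x y" "0 < orient y z"
  shows "orient x z < orient x y + orient y z"
proof (rule ccontr)
  assume "\<not> ?thesis"
  then have le: "orient x y + orient y z \<le> orient x z" by simp
  with pos have d: "0 < orient x z" by linarith
  \<comment> \<open>Coefficients of \<open>y - p0\<close> in the basis \<open>x - p0\<close>,
    \<open>z - p0\<close>, by Cramer's rule.\<close>
  define \<alpha> \<beta> where "\<alpha> = orient y z / orient x z" and "\<beta> = orient x y / orient x z"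
  have \<alpha>\<beta>: "0 \<le> \<alpha>" "0 \<le> \<beta>" "\<alpha> + \<beta> \<le> 1"
    using pos d le by (auto simp: \<alpha>_def \<beta>_def field_simps)
  have "y - p0 = \<alpha> *\<^sub>R (x - p0) + \<beta> *\<^sub>R (z - p0)"
  proof (rule coords_eqI)
    have "(a \<bullet> (y - p0)) * orient x z = orient y z * (a \<bullet> (x - p0)) + orient x y * (a \<bullet> (z - p0))"
      by (simp add: orient_def algebra_simps)
    then show "a \<bullet> (y - p0) = a \<bullet> (\<alpha> *\<^sub>R (x - p0) + \<beta> *\<^sub>R (z - p0))"
      unfolding inner_add_right inner_scaleR_right using d by (simp add: \<alpha>_def \<beta>_def field_simps)
    have "(b \<bullet> (y - p0)) * orient x z = orient y z * (b \<bullet> (x - p0)) + orient x y * (b \<bullet> (z - p0))"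
      by (simp add: orient_def algebra_simps)
    then show "b \<bullet> (y - p0) = b \<bullet> (\<alpha> *\<^sub>R (x - p0) + \<beta> *\<^sub>R (z - p0))"
      unfolding inner_add_right inner_scaleR_right using d by (simp add: \<alpha>_def \<beta>_def field_simps)
  qed
  then have "y = (1 - \<alpha> - \<beta>) *\<^sub>R p0 + \<alpha> *\<^sub>R x + \<beta> *\<^sub>R z" by (simp add: algebra_simps)
  then have "y \<in> convex hull {p0, x, z}" unfolding convex_hull_3 using \<alpha>\<beta>
    by (intro CollectI exI[of _ "1 - \<alpha> - \<beta>"] exI[of _ \<alpha>] exI[of _ \<beta>]) auto
  moreover have "{p0, x, z} \<subseteq> insert p0 (insert p2 Y) - {y}"
    using Y xyz unfolding convex_chain_iff by auto
  ultimately have "y \<in> convex hull (insert p0 (insert p2 Y) - {y})" using hull_mono by blast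
  then show False using Y xyz unfolding convex_chain_iff by auto
qed

text \<open>Strictness expresses that a chain point is off the side from \<open>p0\<close> to
  \<open>p2\<close>, where it would be a convex combination of the two endpoints. It also makes the
  first coordinate positive, so that slopes seen from \<open>p0\<close> are defined.\<close>

lemma chain_point_coords:
  assumes Y: "convex_chain p0 p1 p2 Y" and y: "y \<in> Y"
  shows "0 \<le> b \<bullet> (y - p0)" "b \<bullet> (y - p0) < a \<bullet> (y - p0)" "a \<bullet> (y - p0) \<le> 1"
proof -
  have *: "0 \<le> b \<bullet> (y - p0)" "b \<bullet> (y - p0) \<le> a \<bullet> (y - p0)" "a \<bullet> (y - p0) \<le> 1"
    using Y y triangle_iff[of y] unfolding convex_chain_iff by auto
  then show "0 \<le> b \<bullet> (y - p0)" "a \<bullet> (y - p0) \<le> 1" by auto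
  show "b \<bullet> (y - p0) < a \<bullet> (y - p0)"
  proof (rule ccontr)
    define t where "t = a \<bullet> (y - p0)"
    assume "\<not> ?thesis"
    then have "b \<bullet> (y - p0) = t" using * by (simp add: t_def)
    then have "y - p0 = t *\<^sub>R (p2 - p0)"
      using dual_p2 by (intro coords_eqI) (simp_all add: t_def)
    then have "y = (1 - t) *\<^sub>R p0 + t *\<^sub>R p2" by (simp add: algebra_simps)
    then have "y \<in> closed_segment p0 p2" using * by (auto simp: closed_segment_def t_def)
    then have "y \<in> convex hull {p0, p2}" by (simp add: segment_convex_hull)
    moreover have "{p0, p2} \<subseteq> insert p0 (insert p2 Y) - {y}"
      using Y y unfolding convex_chain_iff by auto
    ultimately have "y \<in> convex hull (insert p0 (insert p2 Y) - {y})" using hull_mono by blast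
    then show False using Y y unfolding convex_chain_iff by auto
  qed
qed

text \<open>Of two distinct points on one ray from \<open>p0\<close>, the nearer one lies on the
  segment from \<open>p0\<close> to the farther one and is no vertex.\<close>

lemma chain_slope_inj:
  assumes Y: "convex_chain p0 p1 p2 Y"
  shows "inj_on (\<lambda>y. b \<bullet> (y - p0) / (a \<bullet> (y - p0))) Y"
proof (rule inj_onI)
  have *: "y = z" if yz: "y \<in> Y" "z \<in> Y" "a \<bullet> (y - p0) \<le> a \<bullet> (z - p0)"
    "b \<bullet> (y - p0) / (a \<bullet> (y - p0)) = b \<bullet> (z - p0) / (a \<bullet> (z - p0))" for y z
  proof (rule ccontr)
    assume ne: "y \<noteq> z"
    define t where "t = a \<bullet> (y - p0) / (a \<bullet> (z - p0))"
    have pos: "0 < a \<bullet> (y - p0)" "0 < a \<bullet> (z - p0)"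
      using chain_point_coords[OF Y yz(1)] chain_point_coords[OF Y yz(2)] by auto
    have t: "0 \<le> t" "t \<le> 1" using yz pos by (auto simp: t_def)
    have "y - p0 = t *\<^sub>R (z - p0)"
      by (rule coords_eqI; unfold inner_scaleR_right) (use pos yz(4) in \<open>simp_all add: t_def field_simps\<close>)
    then have "y = (1 - t) *\<^sub>R p0 + t *\<^sub>R z" by (simp add: algebra_simps)
    then have "y \<in> closed_segment p0 z" using t by (auto simp: closed_segment_def)
    then have "y \<in> convex hull {p0, z}" by (simp add: segment_convex_hull)
    moreover have "{p0, z} \<subseteq> insert p0 (insert p2 Y) - {y}"
      using Y yz ne unfolding convex_chain_iff by auto
    ultimately have "y \<in> convex hull (insert p0 (insert p2 Y) - {y})" using hull_mono by blast
    then show False using Y yz unfolding convex_chain_iff by auto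
  qed
  fix y z assume "y \<in> Y" "z \<in> Y" "b \<bullet> (y - p0) / (a \<bullet> (y - p0)) = b \<bullet> (z - p0) / (a \<bullet> (z - p0))"
  then show "y = z" using *[of y z] *[of z y] by (metis linear)
qed

text \<open>The points are listed by increasing angle at \<open>p0\<close>, measured by the slope;
  by injectivity the sorted list of slopes determines the points.\<close>

lemma chain_enumeration:
  assumes Y: "convex_chain p0 p1 p2 Y" and k: "card Y = k"
  obtains q where "bij_betw q {..<k} Y" "\<And>i j. i < j \<Longrightarrow> j < k \<Longrightarrow> 0 < orient (q i) (q j)"
proof -
  define r where "r = (\<lambda>y. b \<bullet> (y - p0) / (a \<bullet> (y - p0)))"
  define l where "l = sorted_list_of_set (r ` Y)"
  have fin: "finite Y" using Y unfolding convex_chain_iff by auto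
  have inj: "inj_on r Y" unfolding r_def by (rule chain_slope_inj[OF Y])
  have l: "set l = r ` Y" "length l = k" "sorted_wrt (<) l"
    unfolding l_def using fin inj k by (simp_all add: card_image strict_sorted_list_of_set)
  define q where "q i = inv_into Y r (l ! i)" for i
  have li: "l ! i \<in> r ` Y" if "i < k" for i using l that nth_mem by metis
  have q: "q i \<in> Y" "r (q i) = l ! i" if "i < k" for i
    unfolding q_def using li[OF that] by (auto simp: inv_into_into f_inv_into_f)
  have mono: "r (q i) < r (q j)" if "i < j" "j < k" for i j
    using l(2,3) that by (simp add: q sorted_wrt_iff_nth_less)
  have "inj_on q {..<k}"
  proof (rule inj_onI)
    fix i j assume "i \<in> {..<k}" "j \<in> {..<k}" "q i = q j"
    then show "i = j" using mono[of i j] mono[of j i] by (cases i j rule: linorder_cases) auto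
  qed
  moreover have "q ` {..<k} = Y"
    by (rule card_subset_eq) (use fin q k calculation in \<open>auto simp: card_image\<close>)
  ultimately have "bij_betw q {..<k} Y" by (simp add: bij_betw_def)
  moreover have "0 < orient (q i) (q j)" if ij: "i < j" "j < k" for i j
  proof -
    have "0 < a \<bullet> (q i - p0)" "0 < a \<bullet> (q j - p0)"
      using chain_point_coords[OF Y q(1)[of i]] chain_point_coords[OF Y q(1)[of j]] ij by auto
    then show ?thesis using mono[OF ij] by (simp add: r_def orient_def field_simps)
  qed
  ultimately show ?thesis by (rule that)
qed

text \<open>Angular order alone does not exclude a backward step; the turn at \<open>z\<close> on
  the way to the final vertex \<open>p2\<close> does. With \<open>d = orient y z\<close> it reads
  \<open>u - v < (u' - v') + d\<close>. Multiply by \<open>u\<close> or by \<open>v\<close>, both at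
  most 1, and use \<open>u (u' - v') + d = u' (u - v)\<close> and
  \<open>v (u' - v') + d = v' (u - v)\<close>.\<close>

lemma chain_monotone:
  assumes Y: "convex_chain p0 p1 p2 Y" and yz: "y \<in> Y" "z \<in> Y" and pos: "0 < orient y z"
  shows "a \<bullet> y \<le> a \<bullet> z" "b \<bullet> y \<le> b \<bullet> z"
proof -
  define u v u' v' where "u = a \<bullet> (y - p0)" and "v = b \<bullet> (y - p0)" and "u' = a \<bullet> (z - p0)" and "v' = b \<bullet> (z - p0)"
  note defs = u_def v_def u'_def v'_def
  have uv: "0 \<le> v" "v < u" "u \<le> 1" "0 \<le> v'" "v' < u'" "u' \<le> 1"
    unfolding defs using chain_point_coords[OF Y yz(1)] chain_point_coords[OF Y yz(2)] by auto
  have o: "orient y z = u * v' - v * u'" "orient z p2 = u' - v'" "orient y p2 = u - v"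
    unfolding orient_def dual_p2 defs by simp_all
  have "z \<noteq> y" using pos by (auto simp: orient_def mult.commute)
  moreover have "p2 \<noteq> z" using Y yz unfolding convex_chain_iff by auto
  ultimately have "orient y p2 < orient y z + orient z p2"
    using uv pos by (intro chain_turn[OF Y]) (auto simp: o yz)
  then have turn: "u - v < (u' - v') + (u * v' - v * u')" by (simp add: o)
  have d: "0 < u * v' - v * u'" using pos by (simp add: o)
  have "u * (u - v) \<le> u * ((u' - v') + (u * v' - v * u'))" using turn uv by (intro mult_left_mono) auto
  also have "\<dots> \<le> u * (u' - v') + 1 * (u * v' - v * u')"
    unfolding distrib_left using d uv by (intro add_left_mono mult_right_mono) auto
  also have "\<dots> = u' * (u - v)" by (simp add: algebra_simps)
  finally have "u \<le> u'" using uv by simp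
  then show "a \<bullet> y \<le> a \<bullet> z" by (simp add: u_def u'_def inner_diff_right)
  have "v * (u - v) \<le> v * ((u' - v') + (u * v' - v * u'))" using turn uv by (intro mult_left_mono) auto
  also have "\<dots> \<le> v * (u' - v') + 1 * (u * v' - v * u')"
    unfolding distrib_left using d uv by (intro add_left_mono mult_right_mono) auto
  also have "\<dots> = v' * (u - v)" by (simp add: algebra_simps)
  finally have "v \<le> v'" using uv by simp
  then show "b \<bullet> y \<le> b \<bullet> z" by (simp add: v_def v'_def inner_diff_right)
qed

lemma chain_convex_steps:
  assumes Y: "convex_chain p0 p1 p2 Y" and k: "card Y = k"
  obtains q where "bij_betw q {..<k} Y" "convex_steps k (steps q)"
proof -
  obtain q where q: "bij_betw q {..<k} Y" and pos: "\<And>i j. i < j \<Longrightarrow> j < k \<Longrightarrow> 0 < orient (q i) (q j)"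
    using chain_enumeration[OF Y k] by blast
  have qY: "q i \<in> Y" if "i < k" for i using q that by (auto simp: bij_betw_def)
  have nonneg: "0 \<le> a \<bullet> steps q i \<and> 0 \<le> b \<bullet> steps q i" if i: "i < k" for i
  proof (cases i)
    case 0
    then show ?thesis using chain_point_coords[OF Y qY[OF i]] by (auto simp: steps_def)
  next
    case (Suc j)
    then show ?thesis using chain_monotone[OF Y qY[of j] qY[OF i] pos[of j i]] i
      by (auto simp: steps_def inner_diff_right)
  qed
  have less: "step_slope (steps q i) < step_slope (steps q (Suc i))" if i: "Suc i < k" for i
  proof (rule step_slope_less)
    \<comment> \<open>For \<open>i = 0\<close> this determinant is
      \<open>orient (q 0) (q 1)\<close>. For \<open>i = Suc j\<close> it is \<open>orient (q j) (q
      i) + orient (q i) (q (Suc i)) - orient (q j) (q (Suc i))\<close>, positive by the turn at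
      \<open>q i\<close>.\<close>
    show "0 < (a \<bullet> steps q i) * (b \<bullet> steps q (Suc i)) - (b \<bullet> steps q i) * (a \<bullet> steps q (Suc i))"
    proof (cases i)
      case 0
      then show ?thesis using pos[of 0 1] i
        by (simp add: steps_def orient_def inner_diff_right algebra_simps)
    next
      case (Suc j)
      have ne: "q m \<noteq> q n" if "m < n" "n < k" for m n
        using q that unfolding bij_betw_def inj_on_def by force
      have "orient (q j) (q (Suc i)) < orient (q j) (q i) + orient (q i) (q (Suc i))"
        using Suc i ne[of j i] ne[of i "Suc i"] by (intro chain_turn[OF Y] pos) (auto simp: qY)
      then show ?thesis using Suc by (simp add: steps_def orient_def inner_diff_right algebra_simps)
    qed
  qed (use nonneg i in auto)
  have "step_slope (steps q i) < step_slope (steps q j)" if "i < j" "j < k" for i j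
    using that
  proof (induction j)
    case (Suc j)
    then show ?case using less[of j] by (cases "i = j") (auto simp: less_Suc_eq)
  qed simp
  moreover have "(\<Sum>i<k. a \<bullet> steps q i + b \<bullet> steps q i) \<le> 2"
  proof (cases k)
    case (Suc m)
    have "(\<Sum>i<Suc n. steps q i) = q n - p0" for n
      by (induction n) (auto simp: steps_def)
    then have "(\<Sum>i<k. a \<bullet> steps q i + b \<bullet> steps q i) = a \<bullet> (q m - p0) + b \<bullet> (q m - p0)"
      unfolding sum.distrib by (simp only: inner_sum_right[symmetric] Suc)
    also have "\<dots> \<le> 2" using chain_point_coords[OF Y qY[of m]] Suc by simp
    finally show ?thesis .
  qed simp
  ultimately have "convex_steps k (steps q)" using nonneg by (simp add: convex_steps_def)
  with q show ?thesis by (rule that)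
qed

end

section \<open>Volumes of step sequences\<close>

lemma nn_integral_lborel_affine:
  fixes f :: "'a::euclidean_space \<Rightarrow> ennreal"
  assumes [measurable]: "f \<in> borel_measurable borel" and c: "c \<noteq> 0"
  shows "(\<integral>\<^sup>+x. f x \<partial>lborel) = ennreal (\<bar>c\<bar> ^ DIM('a)) * (\<integral>\<^sup>+x. f (t + c *\<^sub>R x) \<partial>lborel)"
  by (subst lborel_affine[OF c, of t]) (simp add: nn_integral_density nn_integral_distr nn_integral_cmult)

text \<open>Exchangeability of a product of equal factors, checked on boxes: the preimage of a box
  is the box with its sides permuted by \<open>inv \<sigma>\<close>.\<close>

lemma (in product_sigma_finite) distr_PiM_permute:
  assumes I: "finite I" and \<sigma>: "\<sigma> permutes I" and M: "\<And>i. M i = N"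
  shows "distr (PiM I M) (PiM I M) (\<lambda>w. \<lambda>i\<in>I. w (\<sigma> i)) = PiM I M"
proof (rule PiM_eqI[OF I])
  have meas: "(\<lambda>w. \<lambda>i\<in>I. w (\<sigma> i)) \<in> measurable (PiM I M) (PiM I M)"
    by (rule measurable_restrict)
      (use measurable_component_singleton[of _ I M] permutes_in_image[OF \<sigma>] M in auto)
  fix A assume A: "\<And>i. i \<in> I \<Longrightarrow> A i \<in> sets (M i)"
  let ?B = "\<lambda>i. A (inv \<sigma> i)"
  have B: "?B i \<in> sets (M i)" if "i \<in> I" for i
    using A[of "inv \<sigma> i"] that permutes_in_image[OF permutes_inv[OF \<sigma>]] M by metis
  have "(\<lambda>w. \<lambda>i\<in>I. w (\<sigma> i)) -` Pi\<^sub>E I A \<inter> space (PiM I M) = Pi\<^sub>E I ?B"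
  proof (intro equalityI subsetI)
    fix w assume w: "w \<in> (\<lambda>w. \<lambda>i\<in>I. w (\<sigma> i)) -` Pi\<^sub>E I A \<inter> space (PiM I M)"
    have "w i \<in> A (inv \<sigma> i)" if "i \<in> I" for i
    proof -
      have "inv \<sigma> i \<in> I" using that permutes_in_image[OF permutes_inv[OF \<sigma>]] by metis
      moreover have "\<sigma> (inv \<sigma> i) = i" by (rule permutes_inverses(1)[OF \<sigma>])
      ultimately show ?thesis using w by (force simp: PiE_iff)
    qed
    then show "w \<in> Pi\<^sub>E I ?B" using w by (auto simp: space_PiM PiE_iff)
  next
    fix w assume w: "w \<in> Pi\<^sub>E I ?B"
    have "w (\<sigma> i) \<in> A i" if "i \<in> I" for i
      using w that permutes_in_image[OF \<sigma>] permutes_inverses(2)[OF \<sigma>] by (metis PiE_mem)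
    moreover have "w \<in> space (PiM I M)"
      using w B sets.sets_into_space by (fastforce simp: space_PiM PiE_iff)
    ultimately show "w \<in> (\<lambda>w. \<lambda>i\<in>I. w (\<sigma> i)) -` Pi\<^sub>E I A \<inter> space (PiM I M)"
      by (auto simp: PiE_iff)
  qed
  then have "emeasure (distr (PiM I M) (PiM I M) (\<lambda>w. \<lambda>i\<in>I. w (\<sigma> i))) (Pi\<^sub>E I A) = emeasure (PiM I M) (Pi\<^sub>E I ?B)"
    using A I by (subst emeasure_distr[OF meas]) (auto intro!: sets_PiM_I_finite)
  also have "\<dots> = (\<Prod>i\<in>I. emeasure (M i) (?B i))" by (rule emeasure_PiM[OF I B])
  also have "\<dots> = (\<Prod>i\<in>I. emeasure (M (\<sigma> i)) (?B (\<sigma> i)))"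
    by (rule prod.permute[OF \<sigma>, unfolded comp_def])
  also have "\<dots> = (\<Prod>i\<in>I. emeasure (M i) (A i))"
    by (simp add: permutes_inverses(2)[OF \<sigma>] M)
  finally show "emeasure (distr (PiM I M) (PiM I M) (\<lambda>w. \<lambda>i\<in>I. w (\<sigma> i))) (Pi\<^sub>E I A) = (\<Prod>i\<in>I. emeasure (M i) (A i))" .
qed simp

text \<open>The position of an entry is forced: it is the number of indices with a strictly smaller
  value.\<close>

lemma sorting_permutation_unique:
  fixes f :: "nat \<Rightarrow> 'a::linorder"
  assumes \<sigma>: "\<sigma> permutes {..<k}" "\<forall>i<k. \<forall>j<k. i < j \<longrightarrow> f (\<sigma> i) < f (\<sigma> j)"
    and \<tau>: "\<tau> permutes {..<k}" "\<forall>i<k. \<forall>j<k. i < j \<longrightarrow> f (\<tau> i) < f (\<tau> j)"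
  shows "\<sigma> = \<tau>"
proof -
  have rank: "i = card {m\<in>{..<k}. f m < f (\<rho> i)}"
    if \<rho>: "\<rho> permutes {..<k}" "\<forall>i<k. \<forall>j<k. i < j \<longrightarrow> f (\<rho> i) < f (\<rho> j)" and i: "i < k" for \<rho> i
  proof -
    have iff: "f (\<rho> j) < f (\<rho> i) \<longleftrightarrow> j < i" if "j < k" for j
      using \<rho>(2) i that by (metis less_asym linorder_neqE_nat order_less_irrefl)
    have "{m\<in>{..<k}. f m < f (\<rho> i)} = \<rho> ` {..<i}"
    proof (intro equalityI subsetI)
      fix m assume m: "m \<in> {m\<in>{..<k}. f m < f (\<rho> i)}"
      then have "m \<in> \<rho> ` {..<k}" using permutes_image[OF \<rho>(1)] by auto
      then obtain j where "j < k" "m = \<rho> j" by auto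
      then show "m \<in> \<rho> ` {..<i}" using m iff by auto
    next
      fix m assume "m \<in> \<rho> ` {..<i}"
      then obtain j where j: "j < i" "m = \<rho> j" by auto
      then have "\<rho> j < k" using permutes_in_image[OF \<rho>(1), of j] i by simp
      then show "m \<in> {m\<in>{..<k}. f m < f (\<rho> i)}" using iff[of j] i j by simp
    qed
    then show ?thesis by (simp add: card_image[OF permutes_inj_on[OF \<rho>(1)]])
  qed
  show ?thesis
  proof
    fix i
    show "\<sigma> i = \<tau> i"
    proof (cases "i < k")
      case False then show ?thesis using \<sigma>(1) \<tau>(1) by (simp add: permutes_def)
    next
      case True
      obtain j where j: "j < k" "\<sigma> i = \<tau> j"
        using permutes_image[OF \<tau>(1)] permutes_in_image[OF \<sigma>(1), of i] True by (metis imageE lessThan_iff)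
      have "i = j" using rank[OF \<sigma> True] rank[OF \<tau> j(1)] j(2) by simp
      then show ?thesis using j by simp
    qed
  qed
qed

text \<open>By exchangeability each of the \<open>k!\<close> orderings of the values of
  \<open>s\<close> contributes the same integral. Strict inequalities make the corresponding regions
  disjoint, so together they are bounded by the unrestricted integral, which factorizes.\<close>

lemma nn_integral_sorted_prod_le:
  fixes N :: "'a measure" and s :: "'a \<Rightarrow> real" and h :: "'a \<Rightarrow> ennreal" and k :: nat
  assumes N: "sigma_finite_measure N"
    and s[measurable]: "s \<in> borel_measurable N" and h[measurable]: "h \<in> borel_measurable N"
  defines "sorted_at \<equiv> \<lambda>w. \<forall>i<k. \<forall>j<k. i < j \<longrightarrow> s (w i) < s (w j)"
  shows "fact k * (\<integral>\<^sup>+w. indicator {w. sorted_at w} w * (\<Prod>i<k. h (w i)) \<partial>PiM {..<k} (\<lambda>_. N))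
    \<le> (\<integral>\<^sup>+x. h x \<partial>N) ^ k"
proof -
  interpret N: sigma_finite_measure N by fact
  interpret product_sigma_finite "\<lambda>_::nat. N" by standard
  let ?P = "PiM {..<k} (\<lambda>_. N)" and ?S = "{\<sigma>. \<sigma> permutes {..<k}}"
  define g where "g w = (indicator {w. sorted_at w} w * (\<Prod>i<k. h (w i)) :: ennreal)" for w
  have [measurable]: "Measurable.pred ?P (\<lambda>w. sorted_at w)"
  proof -
    have "Measurable.pred ?P (\<lambda>w. \<forall>i\<in>{..<k}. \<forall>j\<in>{..<k}. i < j \<longrightarrow> s (w i) < s (w j))"
      by measurable
    then show ?thesis by (simp add: sorted_at_def Ball_def)
  qed
  have [measurable]: "g \<in> borel_measurable ?P" unfolding g_def[abs_def] by measurable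
  have perm: "(\<integral>\<^sup>+w. g w \<partial>?P) = (\<integral>\<^sup>+w. indicator {w. sorted_at (w \<circ> \<sigma>)} w * (\<Prod>i<k. h (w i)) \<partial>?P)"
    if \<sigma>: "\<sigma> permutes {..<k}" for \<sigma>
  proof -
    have meas: "(\<lambda>w. \<lambda>i\<in>{..<k}. w (\<sigma> i)) \<in> measurable ?P ?P"
      by (rule measurable_restrict)
        (use measurable_component_singleton[of _ "{..<k}" "\<lambda>_. N"] permutes_in_image[OF \<sigma>] in auto)
    have "(\<integral>\<^sup>+w. g w \<partial>?P) = (\<integral>\<^sup>+w. g w \<partial>distr ?P ?P (\<lambda>w. \<lambda>i\<in>{..<k}. w (\<sigma> i)))"
      using distr_PiM_permute[OF _ \<sigma>] by simp
    also have "\<dots> = (\<integral>\<^sup>+w. g (\<lambda>i\<in>{..<k}. w (\<sigma> i)) \<partial>?P)"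
      by (rule nn_integral_distr[OF meas]) measurable
    also have "\<dots> = (\<integral>\<^sup>+w. indicator {w. sorted_at (w \<circ> \<sigma>)} w * (\<Prod>i<k. h (w i)) \<partial>?P)"
    proof (rule nn_integral_cong)
      fix w
      have "(\<Prod>i<k. h (w i)) = (\<Prod>i<k. h (w (\<sigma> i)))"
        by (rule prod.permute[OF \<sigma>, unfolded comp_def])
      then show "g (\<lambda>i\<in>{..<k}. w (\<sigma> i)) = indicator {w. sorted_at (w \<circ> \<sigma>)} w * (\<Prod>i<k. h (w i))"
        by (simp add: g_def sorted_at_def indicator_def)
    qed
    finally show ?thesis .
  qed
  have mS[measurable]: "Measurable.pred ?P (\<lambda>w. sorted_at (w \<circ> \<sigma>))" if "\<sigma> \<in> ?S" for \<sigma>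
  proof -
    have [measurable]: "(\<lambda>w. w (\<sigma> i)) \<in> measurable ?P N" if "i \<in> {..<k}" for i
      using measurable_component_singleton[of "\<sigma> i" "{..<k}" "\<lambda>_. N"] that \<open>\<sigma> \<in> ?S\<close>
        permutes_in_image[of \<sigma> "{..<k}" i] by auto
    have "Measurable.pred ?P (\<lambda>w. \<forall>i\<in>{..<k}. \<forall>j\<in>{..<k}. i < j \<longrightarrow> s (w (\<sigma> i)) < s (w (\<sigma> j)))"
      by measurable
    then show ?thesis by (simp add: sorted_at_def Ball_def)
  qed
  have "fact k * (\<integral>\<^sup>+w. g w \<partial>?P) = (\<Sum>\<sigma>\<in>?S. \<integral>\<^sup>+w. g w \<partial>?P)"
    by (simp add: card_permutations[OF refl])
  also have "\<dots> = (\<Sum>\<sigma>\<in>?S. \<integral>\<^sup>+w. indicator {w. sorted_at (w \<circ> \<sigma>)} w * (\<Prod>i<k. h (w i)) \<partial>?P)"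
    by (intro sum.cong refl perm) simp
  also have "\<dots> = (\<integral>\<^sup>+w. (\<Sum>\<sigma>\<in>?S. indicator {w. sorted_at (w \<circ> \<sigma>)} w * (\<Prod>i<k. h (w i))) \<partial>?P)"
    by (rule nn_integral_sum[symmetric]) (use mS in measurable)
  also have "\<dots> \<le> (\<integral>\<^sup>+w. (\<Prod>i<k. h (w i)) \<partial>?P)"
  proof (rule nn_integral_mono)
    fix w
    have "card {\<sigma>\<in>?S. sorted_at (w \<circ> \<sigma>)} \<le> 1"
      unfolding One_nat_def using sorting_permutation_unique[of _ k "\<lambda>i. s (w i)"]
      by (subst card_le_Suc0_iff_eq) (auto simp: sorted_at_def finite_permutations)
    then have "real (card {\<sigma>\<in>?S. sorted_at (w \<circ> \<sigma>)}) \<le> 1" by simp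
    moreover have "(\<Sum>\<sigma>\<in>?S. indicator {w. sorted_at (w \<circ> \<sigma>)} w) = (of_nat (card {\<sigma>\<in>?S. sorted_at (w \<circ> \<sigma>)}) :: ennreal)"
      by (simp add: indicator_def sum.If_cases finite_permutations Int_def)
    ultimately have "(\<Sum>\<sigma>\<in>?S. indicator {w. sorted_at (w \<circ> \<sigma>)} w) \<le> (1::ennreal)"
      by (metis ennreal_1 ennreal_leI ennreal_of_nat_eq_real_of_nat)
    then show "(\<Sum>\<sigma>\<in>?S. indicator {w. sorted_at (w \<circ> \<sigma>)} w * (\<Prod>i<k. h (w i))) \<le> (\<Prod>i<k. h (w i))"
      unfolding sum_distrib_right[symmetric] using mult_right_mono by fastforce
  qed
  also have "\<dots> = (\<integral>\<^sup>+x. h x \<partial>N) ^ k"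
    by (subst product_nn_integral_prod) auto
  finally show ?thesis unfolding g_def .
qed

text \<open>The inverse of \<open>steps\<close> on the first \<open>k\<close> indices when
  \<open>p\<close> is \<open>p0\<close>, made extensional so that it maps into the product
  space.\<close>

definition walk_from :: "'a::real_vector \<Rightarrow> nat \<Rightarrow> (nat \<Rightarrow> 'a) \<Rightarrow> nat \<Rightarrow> 'a" where
  "walk_from p k w = (\<lambda>i\<in>{..<k}. p + (\<Sum>j\<le>i. w j))"

lemma measurable_walk_from:
  "walk_from (p :: 'a :: euclidean_space) k \<in> measurable (PiM {..<k} (\<lambda>_. lborel)) (PiM {..<k} (\<lambda>_. lborel))"
  unfolding walk_from_def[abs_def]
proof (rule measurable_restrict)
  fix i assume "i \<in> {..<k}"
  then have "(\<lambda>x. x j) \<in> measurable (PiM {..<k} (\<lambda>_. lborel)) (borel::'a measure)" if "j \<in> {..i}" for j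
    using measurable_component_singleton[of j "{..<k}" "\<lambda>_. lborel::'a measure"] that by (simp add: measurable_lborel2)
  then show "(\<lambda>w. p + (\<Sum>j\<le>i. w j)) \<in> measurable (PiM {..<k} (\<lambda>_. lborel)) lborel"
    by simp
qed

text \<open>Passing from points to increments is a composition of shears, hence volume preserving.\<close>

lemma nn_integral_uniform_PiM_le:
  fixes T :: "'a::euclidean_space set" and f :: "(nat \<Rightarrow> 'a) \<Rightarrow> ennreal"
  assumes T: "T \<in> sets borel" and A: "emeasure lborel T = ennreal A" "0 < A"
    and f: "f \<in> borel_measurable (PiM {..<k} (\<lambda>_. lborel))"
  shows "(\<integral>\<^sup>+q. f q \<partial>PiM {..<k} (\<lambda>_. uniform_measure lborel T))
    \<le> (\<integral>\<^sup>+w. f (walk_from p k w) \<partial>PiM {..<k} (\<lambda>_. lborel)) / ennreal (A ^ k)"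
  using f
proof (induction k arbitrary: f)
  case 0
  show ?case by (simp add: PiM_empty nn_integral_count_space_finite walk_from_def divide_ennreal_def)
next
  case (Suc k)
  let ?U = "uniform_measure lborel T" and ?L = "\<lambda>k. PiM {..<k} (\<lambda>_. lborel :: 'a measure)"
  have "prob_space ?U" using A by (intro prob_space_uniform_measure) auto
  then interpret U: product_prob_space "\<lambda>_::nat. ?U" UNIV
    by (simp add: product_prob_space_def product_prob_space_axioms_def product_sigma_finite_def prob_space_imp_sigma_finite)
  interpret L: product_sigma_finite "\<lambda>_::nat. lborel :: 'a measure"
    by (simp add: product_sigma_finite_def sigma_finite_lborel)
  have setsU: "sets (PiM J (\<lambda>_. ?U)) = sets (PiM J (\<lambda>_. lborel))" for J :: "nat set"
    by (intro sets_PiM_cong) auto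
  note [measurable] = Suc.prems
  have fI: "f \<in> borel_measurable (PiM (insert k {..<k}) (\<lambda>_. lborel))"
    using Suc.prems by (simp add: lessThan_Suc)
  have add: "(\<lambda>(x, y). f (x(k := y))) \<in> borel_measurable (?L k \<Otimes>\<^sub>M lborel)"
    using measurable_compose[OF measurable_add_dim[of k "{..<k}" "\<lambda>_. lborel"] fI] by (simp add: case_prod_unfold)
  define h where "h x = (\<integral>\<^sup>+y. f (x(k := y)) \<partial>lborel)" for x
  have h: "h \<in> borel_measurable (?L k)"
    unfolding h_def[abs_def] by (rule lborel.borel_measurable_nn_integral[OF add])
  have sec: "(\<lambda>y. f (x(k := y))) \<in> borel_measurable borel" if "x \<in> space (?L k)" for x
    using measurable_compose[OF measurable_Pair1'[OF that, of lborel] add] by simp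
  have "(\<integral>\<^sup>+q. f q \<partial>PiM {..<Suc k} (\<lambda>_. ?U)) = (\<integral>\<^sup>+x. (\<integral>\<^sup>+y. f (x(k := y)) \<partial>?U) \<partial>PiM {..<k} (\<lambda>_. ?U))"
    unfolding lessThan_Suc
    by (rule U.product_nn_integral_insert) (use fI measurable_cong_sets[OF setsU refl] in auto)
  also have "\<dots> \<le> (\<integral>\<^sup>+x. h x / ennreal A \<partial>PiM {..<k} (\<lambda>_. ?U))"
  proof (rule nn_integral_mono)
    fix x assume "x \<in> space (PiM {..<k} (\<lambda>_. ?U))"
    then have x: "x \<in> space (?L k)" by (simp add: space_PiM)
    have "(\<integral>\<^sup>+y. f (x(k := y)) \<partial>?U) = (\<integral>\<^sup>+y. f (x(k := y)) * indicator T y \<partial>lborel) / emeasure lborel T"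
      by (rule nn_integral_uniform_measure) (use sec[OF x] T in auto)
    \<comment> \<open>The condition that the new point lies in \<open>T\<close> is dropped, which
      leaves the increments unconstrained and turns the equality into an inequality.\<close>
    also have "\<dots> \<le> h x / ennreal A"
      unfolding h_def A(1) by (intro divide_right_mono_ennreal nn_integral_mono) (auto simp: indicator_def)
    finally show "(\<integral>\<^sup>+y. f (x(k := y)) \<partial>?U) \<le> h x / ennreal A" .
  qed
  also have "\<dots> = (\<integral>\<^sup>+x. h x \<partial>PiM {..<k} (\<lambda>_. ?U)) / ennreal A"
    by (rule nn_integral_divide) (use h measurable_cong_sets[OF setsU refl] in auto)
  also have "\<dots> \<le> ((\<integral>\<^sup>+w. h (walk_from p k w) \<partial>?L k) / ennreal (A ^ k)) / ennreal A"
    by (intro divide_right_mono_ennreal Suc.IH h)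
  also have "\<dots> = (\<integral>\<^sup>+w. h (walk_from p k w) \<partial>?L k) / ennreal (A ^ Suc k)"
  proof -
    have "inverse (ennreal (A ^ Suc k)) = inverse (ennreal (A ^ k)) * inverse (ennreal A)"
      using A by (simp add: inverse_ennreal ennreal_mult'[symmetric] mult.commute del: power_Suc) (simp add: mult.commute)
    then show ?thesis by (simp add: divide_ennreal_def mult.assoc)
  qed
  also have "(\<integral>\<^sup>+w. h (walk_from p k w) \<partial>?L k) = (\<integral>\<^sup>+w. (\<integral>\<^sup>+y. f (walk_from p (Suc k) (w(k := y))) \<partial>lborel) \<partial>?L k)"
  proof (rule nn_integral_cong)
    fix w assume w: "w \<in> space (?L k)"
    have px: "walk_from p k w \<in> space (?L k)" using measurable_space[OF measurable_walk_from w] .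
    have "h (walk_from p k w) = (\<integral>\<^sup>+y. f ((walk_from p k w)(k := (p + (\<Sum>j<k. w j)) + 1 *\<^sub>R y)) \<partial>lborel)"
      unfolding h_def by (subst nn_integral_lborel_affine[OF sec[OF px], of 1 "p + (\<Sum>j<k. w j)"]) auto
    also have "(\<lambda>y. (walk_from p k w)(k := (p + (\<Sum>j<k. w j)) + 1 *\<^sub>R y)) = (\<lambda>y. walk_from p (Suc k) (w(k := y)))"
    proof (intro ext)
      fix y i
      have "(\<Sum>j\<le>i. (w(k := y)) j) = (\<Sum>j\<le>i. w j)" if "i < k"
        using that by (intro sum.cong) auto
      moreover have "(\<Sum>j\<le>k. (w(k := y)) j) = (\<Sum>j<k. w j) + y"
        by (simp add: lessThan_Suc_atMost[symmetric])
      ultimately show "((walk_from p k w)(k := (p + (\<Sum>j<k. w j)) + 1 *\<^sub>R y)) i = walk_from p (Suc k) (w(k := y)) i"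
        by (auto simp: walk_from_def less_Suc_eq)
    qed
    finally show "h (walk_from p k w) = (\<integral>\<^sup>+y. f (walk_from p (Suc k) (w(k := y))) \<partial>lborel)" by metis
  qed
  also have "\<dots> = (\<integral>\<^sup>+w. f (walk_from p (Suc k) w) \<partial>?L (Suc k))"
    unfolding lessThan_Suc
    by (rule L.product_nn_integral_insert[symmetric])
      (use measurable_compose[OF measurable_walk_from[of p "Suc k"] Suc.prems] in \<open>auto simp: lessThan_Suc\<close>)
  finally show ?case .
qed

section \<open>Exponential weights on the cone of admissible steps\<close>

context triangle_coords
begin

lemma triangle_borel: "T \<in> sets borel"
  using compact_triangle_hull by (simp add: borel_compact)

definition cone_below :: "real \<Rightarrow> (real ^ 2) set" where
  "cone_below r = {w. 0 \<le> a \<bullet> w \<and> 0 \<le> b \<bullet> w \<and> a \<bullet> w + b \<bullet> w \<le> r}"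

lemma cone_below_borel: "cone_below r \<in> sets borel"
  unfolding cone_below_def by measurable

text \<open>The unit corner of the cone is contained in the parallelogram spanned by the two edges,
  which splits into a translate of the triangle and a point reflection of it.\<close>

lemma emeasure_cone_below_1: "emeasure lborel (cone_below 1) \<le> 2 * emeasure lborel T"
proof -
  have [measurable]: "T \<in> sets borel" by (rule triangle_borel)
  have "indicator (cone_below 1) w \<le> indicator T (p0 + 1 *\<^sub>R w) + (indicator T (p2 + (-1) *\<^sub>R w) :: ennreal)" for w
  proof (cases "w \<in> cone_below 1")
    case True
    then have w: "0 \<le> a \<bullet> w" "0 \<le> b \<bullet> w" "a \<bullet> w + b \<bullet> w \<le> 1" by (auto simp: cone_below_def)
    have "p2 - w - p0 = (p2 - p0) - w" by simp
    then have "a \<bullet> (p2 - w - p0) = 1 - a \<bullet> w" "b \<bullet> (p2 - w - p0) = 1 - b \<bullet> w"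
      using dual_p2 by (simp_all add: inner_diff_right)
    \<comment> \<open>The first alternative holds if
      \<open>b \<bullet> w \<le> a \<bullet> w\<close>, the second in the opposite case.\<close>
    then have "p0 + 1 *\<^sub>R w \<in> T \<or> p2 + (-1) *\<^sub>R w \<in> T"
      using w unfolding triangle_iff by auto
    then show ?thesis by (auto simp: indicator_def)
  qed (simp add: indicator_def)
  then have "(\<integral>\<^sup>+w. indicator (cone_below 1) w \<partial>lborel)
      \<le> (\<integral>\<^sup>+w. indicator T (p0 + 1 *\<^sub>R w) + indicator T (p2 + (-1) *\<^sub>R w) \<partial>lborel)"
    by (intro nn_integral_mono)
  also have "\<dots> = (\<integral>\<^sup>+w. indicator T (p0 + 1 *\<^sub>R w) \<partial>lborel) + (\<integral>\<^sup>+w. indicator T (p2 + (-1) *\<^sub>R w) \<partial>lborel)"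
    by (rule nn_integral_add) measurable
  also have "(\<integral>\<^sup>+w. indicator T (p0 + 1 *\<^sub>R w) \<partial>lborel) = emeasure lborel T"
    using nn_integral_lborel_affine[of "indicator T" 1 p0] by simp
  also have "(\<integral>\<^sup>+w. indicator T (p2 + (-1) *\<^sub>R w) \<partial>lborel) = emeasure lborel T"
    using nn_integral_lborel_affine[of "indicator T" "-1" p2] by simp
  finally show ?thesis using cone_below_borel by (simp add: mult_2)
qed

lemma emeasure_cone_below:
  assumes r: "0 < r"
  shows "emeasure lborel (cone_below r) \<le> ennreal (r\<^sup>2) * (2 * emeasure lborel T)"
proof -
  note [measurable] = cone_below_borel
  have "(\<integral>\<^sup>+w. indicator (cone_below r) w \<partial>lborel)
     = ennreal (r\<^sup>2) * (\<integral>\<^sup>+w. indicator (cone_below r) (0 + r *\<^sub>R w) \<partial>lborel)"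
    using nn_integral_lborel_affine[of "indicator (cone_below r)" r 0] r by simp
  also have "(\<lambda>w. indicator (cone_below r) (0 + r *\<^sub>R w) :: ennreal) = indicator (cone_below 1)"
    using r by (auto simp: cone_below_def indicator_def fun_eq_iff zero_le_mult_iff distrib_left[symmetric])
  finally have "emeasure lborel (cone_below r) = ennreal (r\<^sup>2) * emeasure lborel (cone_below 1)" by simp
  then show ?thesis using emeasure_cone_below_1 by (simp add: mult_left_mono)
qed

definition cone_weight :: "real \<Rightarrow> real ^ 2 \<Rightarrow> ennreal" where
  "cone_weight l w = indicator {w. 0 \<le> a \<bullet> w \<and> 0 \<le> b \<bullet> w} w * ennreal (exp (- (l * (a \<bullet> w + b \<bullet> w))))"

lemma cone_weight_measurable[measurable]: "cone_weight l \<in> borel_measurable borel"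
  unfolding cone_weight_def[abs_def] by measurable

text \<open>Layer-cake formula: \<open>exp (- s)\<close> is the integral of \<open>exp (- r)\<close>
  over \<open>r \<ge> s\<close>. After exchanging the integrals, the inner one is the area of
  \<open>cone_below r\<close>, at most \<open>2 r^2\<close> times that of \<open>T\<close>. The
  integral of \<open>r^2 exp (- r)\<close> over the half-line is 2, which gives the factor
  4.\<close>

lemma nn_integral_cone_weight_1: "(\<integral>\<^sup>+w. cone_weight 1 w \<partial>lborel) \<le> 4 * emeasure lborel T"
proof -
  have exp_tail: "(\<integral>\<^sup>+r. ennreal (exp (- r)) * indicator {m..} r \<partial>lborel) = ennreal (exp (- m))" for m :: real
  proof -
    have "(\<integral>\<^sup>+r. ennreal (exp (- r)) * indicator {m..} r \<partial>lborel) = 0 - (- exp (- m))"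
    proof (rule nn_integral_FTC_atLeast)
      show "((\<lambda>r::real. - exp (- r)) \<longlongrightarrow> 0) at_top"
        using tendsto_minus[OF filterlim_compose[OF exp_at_bot filterlim_uminus_at_bot_at_top]] by simp
    qed (auto intro!: derivative_eq_intros)
    then show ?thesis by simp
  qed
  have meas: "(\<lambda>(r, w). indicator (cone_below r) w * ennreal (exp (- r))) \<in> borel_measurable (lborel \<Otimes>\<^sub>M lborel)"
  proof -
    have "(\<lambda>(r, w). indicator (cone_below r) w * ennreal (exp (- r)))
      = (\<lambda>x. indicator {x. 0 \<le> a \<bullet> snd x \<and> 0 \<le> b \<bullet> snd x \<and> a \<bullet> snd x + b \<bullet> snd x \<le> fst x} x * ennreal (exp (- fst x)))"
      by (auto simp: fun_eq_iff cone_below_def indicator_def)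
    also have "\<dots> \<in> borel_measurable (lborel \<Otimes>\<^sub>M lborel)"
      by measurable
    finally show ?thesis .
  qed
  have "cone_weight 1 w = (\<integral>\<^sup>+r. indicator (cone_below r) w * ennreal (exp (- r)) \<partial>lborel)" for w
  proof -
    have "(\<integral>\<^sup>+r. indicator (cone_below r) w * ennreal (exp (- r)) \<partial>lborel)
      = (\<integral>\<^sup>+r. indicator {w. 0 \<le> a \<bullet> w \<and> 0 \<le> b \<bullet> w} w * (ennreal (exp (- r)) * indicator {a \<bullet> w + b \<bullet> w..} r) \<partial>lborel)"
      by (intro nn_integral_cong) (auto simp: cone_below_def indicator_def)
    also have "\<dots> = cone_weight 1 w"
      by (simp add: nn_integral_cmult exp_tail cone_weight_def)
    finally show ?thesis by simp
  qed
  then have "(\<integral>\<^sup>+w. cone_weight 1 w \<partial>lborel)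
     = (\<integral>\<^sup>+w. (\<integral>\<^sup>+r. indicator (cone_below r) w * ennreal (exp (- r)) \<partial>lborel) \<partial>lborel)"
    by simp
  also have "\<dots> = (\<integral>\<^sup>+r. (\<integral>\<^sup>+w. indicator (cone_below r) w * ennreal (exp (- r)) \<partial>lborel) \<partial>lborel)"
    by (rule lborel_pair.Fubini'[OF meas])
  also have "\<dots> = (\<integral>\<^sup>+r. emeasure lborel (cone_below r) * ennreal (exp (- r)) \<partial>lborel)"
    using cone_below_borel by (simp add: nn_integral_multc)
  also have "\<dots> \<le> (\<integral>\<^sup>+r. ennreal (r ^ 2 * exp (- r)) * indicator {0..} r * (2 * emeasure lborel T) \<partial>lborel)"
  proof (rule nn_integral_mono_AE)
    \<comment> \<open>For \<open>r < 0\<close> the region is empty and for \<open>r > 0\<close> the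
      dilation bound applies; \<open>r = 0\<close>, where the region is a single point, is discarded
      as a null set.\<close>
    have "AE r in lborel. r \<noteq> (0::real)" by (rule AE_lborel_singleton)
    then show "AE r in lborel. emeasure lborel (cone_below r) * ennreal (exp (- r))
      \<le> ennreal (r ^ 2 * exp (- r)) * indicator {0..} r * (2 * emeasure lborel T)"
    proof eventually_elim
      case (elim r)
      show ?case
      proof (cases "0 < r")
        case True
        have "emeasure lborel (cone_below r) * ennreal (exp (- r))
          \<le> ennreal (r\<^sup>2) * (2 * emeasure lborel T) * ennreal (exp (- r))"
          by (intro mult_right_mono emeasure_cone_below True) simp
        then show ?thesis using True by (simp add: ennreal_mult mult_ac)
      next
        case False
        then have "cone_below r = {}" using elim by (auto simp: cone_below_def)
        then show ?thesis by simp
      qed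
    qed
  qed
  also have "\<dots> = (\<integral>\<^sup>+r. ennreal (r ^ 2 * exp (- r)) * indicator {0..} r \<partial>lborel) * (2 * emeasure lborel T)"
    by (rule nn_integral_multc) measurable
  also have "\<dots> = 4 * emeasure lborel T"
    unfolding nn_intergal_power_times_exp_Ici by (simp add: fact_numeral mult.assoc[symmetric] ennreal_mult'[symmetric] flip: ennreal_numeral)
  finally show ?thesis .
qed

lemma nn_integral_cone_weight:
  assumes l: "0 < l"
  shows "(\<integral>\<^sup>+w. cone_weight l w \<partial>lborel) \<le> ennreal (4 / l\<^sup>2) * emeasure lborel T"
proof -
  have "(\<integral>\<^sup>+w. cone_weight l w \<partial>lborel) = ennreal ((1 / l)\<^sup>2) * (\<integral>\<^sup>+w. cone_weight l (0 + (1 / l) *\<^sub>R w) \<partial>lborel)"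
    using nn_integral_lborel_affine[of "cone_weight l" "1 / l" 0] l by simp
  also have "(\<lambda>w. cone_weight l (0 + (1 / l) *\<^sub>R w)) = cone_weight 1"
    using l by (auto simp: cone_weight_def fun_eq_iff indicator_def zero_le_divide_iff add_divide_distrib[symmetric])
  also have "ennreal ((1 / l)\<^sup>2) * (\<integral>\<^sup>+w. cone_weight 1 w \<partial>lborel) \<le> ennreal ((1 / l)\<^sup>2) * (4 * emeasure lborel T)"
    by (intro mult_left_mono nn_integral_cone_weight_1) simp
  also have "\<dots> = ennreal (4 / l\<^sup>2) * emeasure lborel T"
    by (simp add: mult.assoc[symmetric] ennreal_mult'[symmetric] power_divide flip: ennreal_numeral)
  finally show ?thesis .
qed

lemma steps_walk: "i < k \<Longrightarrow> steps (walk_from p0 k w) i = w i"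
  by (cases i) (auto simp: steps_def walk_from_def)

lemma convex_steps_cong:
  assumes "\<And>i. i < k \<Longrightarrow> w i = z i" shows "convex_steps k w = convex_steps k z"
  using assms by (simp add: convex_steps_def)

lemma convex_steps_steps_cong:
  assumes "\<And>i. i < k \<Longrightarrow> q i = q' i" shows "convex_steps k (steps q) = convex_steps k (steps q')"
  by (rule convex_steps_cong) (use assms in \<open>simp add: steps_def\<close>)

lemma step_slope_measurable[measurable]: "step_slope \<in> borel_measurable borel"
  unfolding step_slope_def[abs_def] by measurable

lemma pred_convex_steps_steps:
  assumes U: "sets U = sets borel"
  shows "Measurable.pred (PiM {..<k} (\<lambda>_. U)) (\<lambda>q. convex_steps k (steps q))"
proof -
  have comp: "(\<lambda>q. q i) \<in> borel_measurable (PiM {..<k} (\<lambda>_. U))" if "i < k" for i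
  proof -
    have "(\<lambda>q. q i) \<in> measurable (PiM {..<k} (\<lambda>_. U)) U"
      by (rule measurable_component_singleton) (use that in auto)
    then show ?thesis using measurable_cong_sets[OF refl U] by blast
  qed
  have [measurable]: "(\<lambda>q. steps q i) \<in> borel_measurable (PiM {..<k} (\<lambda>_. U))" if "i \<in> {..<k}" for i
    unfolding steps_def using comp[of i] comp[of "i - 1"] that by (cases "i = 0") auto
  have "Measurable.pred (PiM {..<k} (\<lambda>_. U)) (\<lambda>q.
     (\<forall>i\<in>{..<k}. 0 \<le> a \<bullet> steps q i \<and> 0 \<le> b \<bullet> steps q i) \<and>
     (\<forall>i\<in>{..<k}. \<forall>j\<in>{..<k}. i < j \<longrightarrow> step_slope (steps q i) < step_slope (steps q j)) \<and>
     (\<Sum>i\<in>{..<k}. a \<bullet> steps q i + b \<bullet> steps q i) \<le> 2)"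
    by measurable
  then show ?thesis by (simp add: convex_steps_def Ball_def)
qed

text \<open>The sum of all steps lies below the line \<open>a + b = 2\<close>, so the product of the exponential
  weights is at least \<open>exp (- 2 k)\<close>; sorting the slopes contributes the factor \<open>1 / k!\<close>.\<close>

lemma emeasure_convex_steps_le:
  assumes k: "0 < k" and A: "emeasure lborel T = ennreal A" "0 < A"
  defines "P \<equiv> PiM {..<k} (\<lambda>_. uniform_measure lborel T)"
  shows "emeasure P {q\<in>space P. convex_steps k (steps q)} \<le> ennreal (exp (2 * real k) * (4 / (real k)\<^sup>2) ^ k / fact k)"
proof -
  let ?L = "PiM {..<k} (\<lambda>_. lborel :: (real ^ 2) measure)"
  have setsP: "sets P = sets ?L" unfolding P_def by (intro sets_PiM_cong) auto
  have spaceP: "space P = space ?L" unfolding P_def by (simp add: space_PiM)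
  have pL: "Measurable.pred ?L (\<lambda>q. convex_steps k (steps q))" by (rule pred_convex_steps_steps) simp
  then have mL: "{q\<in>space ?L. convex_steps k (steps q)} \<in> sets ?L" by simp
  have "emeasure P {q\<in>space P. convex_steps k (steps q)}
      = (\<integral>\<^sup>+q. indicator {q\<in>space ?L. convex_steps k (steps q)} q \<partial>P)"
    using mL by (simp add: setsP spaceP)
  also have "\<dots> \<le> (\<integral>\<^sup>+w. indicator {q\<in>space ?L. convex_steps k (steps q)} (walk_from p0 k w) \<partial>?L) / ennreal (A ^ k)"
    unfolding P_def by (rule nn_integral_uniform_PiM_le[OF triangle_borel A]) (use mL in measurable)
  \<comment> \<open>The rate \<open>k\<close> in the weight is the value of \<open>l\<close>
    minimizing \<open>exp (2 l) (4 / l^2)^k\<close>, the bound obtained from a general rate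
    \<open>l\<close>.\<close>
  also have "\<dots> \<le> (\<integral>\<^sup>+w. ennreal (exp (2 * real k)) * (indicator {w. \<forall>i<k. \<forall>j<k. i < j \<longrightarrow> step_slope (w i) < step_slope (w j)} w
        * (\<Prod>i<k. cone_weight k (w i))) \<partial>?L) / ennreal (A ^ k)"
  proof (intro divide_right_mono_ennreal nn_integral_mono)
    fix w :: "nat \<Rightarrow> real ^ 2"
    let ?S = "{w. \<forall>i<k. \<forall>j<k. i < j \<longrightarrow> step_slope (w i) < step_slope (w j)}"
    have cs: "convex_steps k (steps (walk_from p0 k w)) = convex_steps k w"
      by (rule convex_steps_cong) (simp add: steps_walk)
    show "indicator {q\<in>space ?L. convex_steps k (steps q)} (walk_from p0 k w)
      \<le> ennreal (exp (2 * real k)) * (indicator ?S w * (\<Prod>i<k. cone_weight k (w i)))"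
    proof (cases "convex_steps k w")
      case True
      then have c: "\<forall>i<k. 0 \<le> a \<bullet> w i \<and> 0 \<le> b \<bullet> w i" "w \<in> ?S" "(\<Sum>i<k. a \<bullet> w i + b \<bullet> w i) \<le> 2"
        by (auto simp: convex_steps_def)
      have "(\<Prod>i<k. cone_weight k (w i)) = (\<Prod>i<k. ennreal (exp (- (k * (a \<bullet> w i + b \<bullet> w i)))))"
        using c by (intro prod.cong) (auto simp: cone_weight_def)
      also have "\<dots> = ennreal (exp (- (k * (\<Sum>i<k. a \<bullet> w i + b \<bullet> w i))))"
        by (simp add: prod_ennreal exp_sum[symmetric] sum_negf sum_distrib_left)
      finally have "ennreal (exp (2 * real k)) * (indicator ?S w * (\<Prod>i<k. cone_weight k (w i)))
          = ennreal (exp (k * (2 - (\<Sum>i<k. a \<bullet> w i + b \<bullet> w i))))"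
        using c(2) by (simp add: ennreal_mult'[symmetric] exp_add[symmetric] algebra_simps)
      also have "\<dots> \<ge> ennreal 1" using c(3) by (intro ennreal_leI) simp
      finally show ?thesis by (auto simp: indicator_def)
    next
      case False
      then show ?thesis by (simp add: cs indicator_def)
    qed
  qed
  also have "\<dots> = ennreal (exp (2 * real k)) * (\<integral>\<^sup>+w. indicator {w. \<forall>i<k. \<forall>j<k. i < j \<longrightarrow> step_slope (w i) < step_slope (w j)} w
        * (\<Prod>i<k. cone_weight k (w i)) \<partial>?L) / ennreal (A ^ k)"
    (is "_ = _ * ?I / _")
  proof (subst nn_integral_cmult)
    have [measurable]: "(\<lambda>w. w i) \<in> borel_measurable ?L" if "i \<in> {..<k}" for i
      using measurable_component_singleton[of i "{..<k}" "\<lambda>_. lborel::(real^2) measure"] that by (simp add: measurable_lborel2)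
    have "Measurable.pred ?L (\<lambda>w. \<forall>i\<in>{..<k}. \<forall>j\<in>{..<k}. i < j \<longrightarrow> step_slope (w i) < step_slope (w j))"
      by measurable
    then have [measurable]: "Measurable.pred ?L (\<lambda>w. \<forall>i<k. \<forall>j<k. i < j \<longrightarrow> step_slope (w i) < step_slope (w j))"
      by (simp add: Ball_def)
    show "(\<lambda>w. indicator {w. \<forall>i<k. \<forall>j<k. i < j \<longrightarrow> step_slope (w i) < step_slope (w j)} w
        * (\<Prod>i<k. cone_weight k (w i))) \<in> borel_measurable ?L" by measurable
  qed simp
  also have "\<dots> \<le> ennreal (exp (2 * real k)) * (ennreal ((4 / (real k)\<^sup>2) ^ k * A ^ k) / ennreal (fact k)) / ennreal (A ^ k)"
  proof (intro divide_right_mono_ennreal mult_left_mono)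
    have "fact k * ?I \<le> (\<integral>\<^sup>+w. cone_weight k w \<partial>lborel) ^ k"
      by (rule nn_integral_sorted_prod_le) (auto simp: sigma_finite_lborel)
    also have "\<dots> \<le> (ennreal (4 / (real k)\<^sup>2) * ennreal A) ^ k"
      unfolding A(1)[symmetric] by (intro power_mono nn_integral_cone_weight) (use k in auto)
    also have "\<dots> = ennreal ((4 / (real k)\<^sup>2) ^ k * A ^ k)"
      using A(2) by (simp add: ennreal_mult'[symmetric] ennreal_power flip: power_mult_distrib)
    finally have le: "fact k * ?I \<le> ennreal ((4 / (real k)\<^sup>2) ^ k * A ^ k)" .
    have f: "fact k = ennreal (fact k)" by (metis ennreal_of_nat_eq_real_of_nat of_nat_fact)
    have "?I = fact k * ?I / ennreal (fact k)"
      unfolding f by (simp add: mult.commute[of "ennreal (fact k)"] mult_divide_eq_ennreal)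
    then show "?I \<le> ennreal ((4 / (real k)\<^sup>2) ^ k * A ^ k) / ennreal (fact k)"
      using divide_right_mono_ennreal[OF le, of "ennreal (fact k)"] by simp
  qed simp
  also have "\<dots> = ennreal (exp (2 * real k) * (4 / (real k)\<^sup>2) ^ k / fact k)"
    using A(2) by (simp add: divide_ennreal ennreal_mult'[symmetric])
  finally show ?thesis .
qed

end

section \<open>Concentration\<close>

context triangle_coords
begin

text \<open>A union bound over injective \<open>k\<close>-tuples of indices. The tuples are ordered,
  because which index comes first in the angular order is itself random; hence the count
  \<open>n^k\<close>. Injectivity of a tuple makes its points independent, so they have the law of
  \<open>k\<close> fresh points.\<close>

lemma prob_longest_chain_ge_le:
  fixes n k :: nat
  assumes k: "0 < k" and A: "emeasure lborel T = ennreal A" "0 < A"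
  defines "P \<equiv> PiM {..<n} (\<lambda>_. uniform_measure lborel T)"
  shows "measure P {x\<in>space P. k \<le> longest_chain p0 p1 p2 (x ` {..<n})}
    \<le> real n ^ k * (exp (2 * real k) * (4 / (real k)\<^sup>2) ^ k / fact k)"
proof -
  let ?U = "uniform_measure lborel T"
  define Pk where "Pk = PiM {..<k} (\<lambda>_. ?U)"
  define c where "c = exp (2 * real k) * (4 / (real k)\<^sup>2) ^ k / fact k"
  define F where "F = {\<iota> \<in> {..<k} \<rightarrow>\<^sub>E {..<n}. inj_on \<iota> {..<k}}"
  define E where "E \<iota> = {x\<in>space P. convex_steps k (steps (\<lambda>i. x (\<iota> i)))}" for \<iota>
  have U: "prob_space ?U" using A by (intro prob_space_uniform_measure) auto
  interpret P: prob_space P unfolding P_def by (rule prob_space_PiM) (rule U)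
  have p02: "p0 \<noteq> p2" using dual_p2 by auto
  have fin: "finite ({..<k} \<rightarrow>\<^sub>E {..<n})" by (rule finite_PiE) auto
  have Fsub: "F \<subseteq> {..<k} \<rightarrow>\<^sub>E {..<n}" unfolding F_def by blast
  have finF: "finite F" by (rule finite_subset[OF Fsub fin])
  have "card F \<le> card ({..<k} \<rightarrow>\<^sub>E {..<n})" by (rule card_mono[OF fin Fsub])
  also have "\<dots> = n ^ k" by (subst card_PiE) auto
  finally have cardF: "card F \<le> n ^ k" .
  have pk: "{q\<in>space Pk. convex_steps k (steps q)} \<in> sets Pk"
    using pred_convex_steps_steps[of ?U k] by (simp add: Pk_def)
  have E: "E \<iota> \<in> sets P \<and> emeasure P (E \<iota>) \<le> ennreal c" if \<iota>: "\<iota> \<in> F" for \<iota>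
  proof -
    let ?r = "\<lambda>x. \<lambda>i\<in>{..<k}. x (\<iota> i)"
    have "\<iota> i \<in> {..<n}" if "i \<in> {..<k}" for i using \<iota> that by (auto simp: F_def)
    then have r: "?r \<in> measurable P Pk"
      unfolding P_def Pk_def by (intro measurable_restrict measurable_component_singleton)
    have d: "distr P Pk ?r = Pk"
      unfolding P_def Pk_def
      by (rule distr_PiM_reindex[of "{..<n}" "\<lambda>_. ?U"]) (use U \<iota> in \<open>auto simp: F_def\<close>)
    have Eeq: "E \<iota> = ?r -` {q\<in>space Pk. convex_steps k (steps q)} \<inter> space P"
      using measurable_space[OF r] convex_steps_steps_cong[of k "?r x" "\<lambda>i. x (\<iota> i)" for x]
      by (auto simp: E_def)
    have "emeasure P (E \<iota>) = emeasure (distr P Pk ?r) {q\<in>space Pk. convex_steps k (steps q)}"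
      unfolding Eeq by (rule emeasure_distr[OF r pk, symmetric])
    also have "\<dots> \<le> ennreal c"
      unfolding d unfolding Pk_def c_def by (rule emeasure_convex_steps_le[OF k A])
    finally show ?thesis using measurable_sets[OF r pk] Eeq by simp
  qed
  have "{x\<in>space P. k \<le> longest_chain p0 p1 p2 (x ` {..<n})} \<subseteq> (\<Union>\<iota>\<in>F. E \<iota>)"
  proof
    fix x assume "x \<in> {x\<in>space P. k \<le> longest_chain p0 p1 p2 (x ` {..<n})}"
    then have x: "x \<in> space P" "k \<le> longest_chain p0 p1 p2 (x ` {..<n})" by auto
    then obtain J where J: "J \<subseteq> {..<n}" "card J = k" "inj_on x J" "convex_chain p0 p1 p2 (x ` J)"
      using longest_chain_le_iff[OF p02, of "{..<n}" k p1 x] by auto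
    obtain q where q: "bij_betw q {..<k} (x ` J)" "convex_steps k (steps q)"
      using chain_convex_steps[OF J(4), of k] J by (auto simp: card_image)
    define \<iota> where "\<iota> = (\<lambda>i\<in>{..<k}. inv_into J x (q i))"
    have qi: "q i \<in> x ` J" if "i < k" for i using q(1) that by (auto simp: bij_betw_def)
    have xq: "x (\<iota> i) = q i" if "i < k" for i
      using qi[OF that] that by (simp add: \<iota>_def f_inv_into_f)
    have "\<iota> \<in> F"
      unfolding F_def
    proof (intro CollectI conjI)
      show "\<iota> \<in> {..<k} \<rightarrow>\<^sub>E {..<n}"
        unfolding \<iota>_def using inv_into_into[OF qi] J(1) by (intro restrict_PiE_iff[THEN iffD2] ballI) auto
      show "inj_on \<iota> {..<k}"
      proof (rule inj_onI)
        fix i j assume ij: "i \<in> {..<k}" "j \<in> {..<k}" "\<iota> i = \<iota> j"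
        then have "q i = q j" using xq[of i] xq[of j] by simp
        then show "i = j" using q(1) ij by (auto simp: bij_betw_def inj_on_def)
      qed
    qed
    moreover have "convex_steps k (steps (\<lambda>i. x (\<iota> i)))"
      using q(2) convex_steps_steps_cong[of k "\<lambda>i. x (\<iota> i)" q] xq by simp
    ultimately show "x \<in> (\<Union>\<iota>\<in>F. E \<iota>)"
      using x(1) by (auto simp: E_def)
  qed
  then have "emeasure P {x\<in>space P. k \<le> longest_chain p0 p1 p2 (x ` {..<n})} \<le> emeasure P (\<Union>\<iota>\<in>F. E \<iota>)"
    using E finF by (intro emeasure_mono) auto
  also have "\<dots> \<le> (\<Sum>\<iota>\<in>F. emeasure P (E \<iota>))"
    using E finF by (intro emeasure_subadditive_finite) auto
  also have "\<dots> \<le> (\<Sum>\<iota>\<in>F. ennreal c)" using E by (intro sum_mono) auto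
  also have "\<dots> = ennreal (real (card F) * c)"
    by (simp add: ennreal_mult' ennreal_of_nat_eq_real_of_nat)
  also have "\<dots> \<le> ennreal (real n ^ k * c)"
    using cardF by (intro ennreal_leI mult_right_mono) (auto simp: c_def simp flip: of_nat_power)
  finally show ?thesis unfolding c_def P.emeasure_eq_measure by (subst (asm) ennreal_le_iff) auto
qed

end

section \<open>Numerical bounds and exponential tail estimates\<close>

lemma power_le_fact_mult_exp:
  fixes x :: real assumes "0 \<le> x" shows "x ^ k \<le> fact k * exp x"
proof -
  obtain t where "exp x = (\<Sum>m<Suc k. x ^ m / fact m) + exp t / fact (Suc k) * x ^ Suc k"
    using Maclaurin_exp_le[of x "Suc k"] by auto
  moreover have "0 \<le> (\<Sum>m<k. x ^ m / fact m)" "0 \<le> exp t / fact (Suc k) * x ^ Suc k"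
    using assms by (auto intro!: sum_nonneg mult_nonneg_nonneg)
  ultimately have "x ^ k / fact k \<le> exp x" by simp
  then show ?thesis by (simp add: field_simps)
qed

text \<open>One term of the exponential series gives \<open>1 / k! \<le> (e / k)^k\<close>, which
  suffices in place of Stirling's formula and turns the left-hand side into a \<open>k\<close>-th
  power with base \<open>4 e^3 n / k^3\<close>. The hypothesis bounds the base by
  \<open>4 e^3 / 125\<close>, about 0.643.\<close>

lemma chain_count_bound:
  assumes k: "0 < k" and n: "125 * real n \<le> real k ^ 3"
  shows "real n ^ k * (exp (2 * real k) * (4 / (real k)\<^sup>2) ^ k / fact k) \<le> (66 / 100) ^ k"
proof -
  have kp: "0 < real k" using k by simp
  have "1 / fact k \<le> exp (real k) / real k ^ k"
    using power_le_fact_mult_exp[of "real k" k] kp by (simp add: field_simps)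
  then have "real n ^ k * (exp (2 * real k) * (4 / (real k)\<^sup>2) ^ k) * (1 / fact k)
    \<le> real n ^ k * (exp (2 * real k) * (4 / (real k)\<^sup>2) ^ k) * (exp (real k) / real k ^ k)"
    by (intro mult_left_mono) auto
  also have "\<dots> = (4 * exp 1 ^ 3 * (real n / real k ^ 3)) ^ k"
  proof -
    have e: "exp (2 * real k) = (exp 1 ^ 2) ^ k" "exp (real k) = exp (1::real) ^ k"
      by (simp_all flip: exp_of_nat_mult power_mult)
    show ?thesis using kp unfolding e
      by (simp add: power_divide power_mult_distrib power2_eq_square power3_eq_cube)
  qed
  also have "\<dots> \<le> (66 / 100) ^ k"
  proof (rule power_mono)
    have "exp 1 ^ 3 \<le> (272 / 100 :: real) ^ 3" using e_less_272 by (intro power_mono) auto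
    moreover have "real n / real k ^ 3 \<le> 1 / 125" using n kp by (simp add: field_simps)
    ultimately have "4 * exp 1 ^ 3 * (real n / real k ^ 3) \<le> 4 * (272 / 100) ^ 3 * (1 / 125)"
      by (intro mult_mono) auto
    also have "\<dots> \<le> 66 / 100" by (simp add: power3_eq_cube)
    finally show "4 * exp 1 ^ 3 * (real n / real k ^ 3) \<le> 66 / 100" .
  qed simp
  finally show ?thesis by simp
qed

text \<open>One second-order bound for both signs of \<open>x\<close>, so that the two tails share a
  computation; the correction \<open>exp \<bar>x\<bar>\<close> tends to 1 for small
  \<open>x\<close>.\<close>

lemma exp_quadratic_upper: "exp x \<le> 1 + x + x\<^sup>2 / 2 * exp \<bar>x\<bar>" for x :: real
proof -
  obtain t where t: "\<bar>t\<bar> \<le> \<bar>x\<bar>" "exp x = (\<Sum>m<2. x ^ m / fact m) + exp t / fact 2 * x ^ 2"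
    using Maclaurin_exp_le[of x 2] by auto
  have "exp t \<le> exp \<bar>x\<bar>" using t(1) by auto
  then have "x\<^sup>2 / 2 * exp t \<le> x\<^sup>2 / 2 * exp \<bar>x\<bar>" by (intro mult_left_mono) auto
  moreover have "exp x = 1 + x + x\<^sup>2 / 2 * exp t" using t(2) by (simp add: numeral_2_eq_2)
  ultimately show ?thesis by linarith
qed

text \<open>Chernoff bounds at \<open>l\<close> and at \<open>- l\<close>. Centring cancels the
  linear term of \<open>exp s - 1\<close>, and the quadratic remainder is multiplied by the mean, so
  an upper bound \<open>v\<close> on the mean serves both tails. The parameter \<open>l\<close>
  stays free and is chosen in terms of \<open>t\<close> and \<open>v\<close> later.\<close>

lemma (in prob_space) poisson_type_deviation:
  fixes Z :: "'a \<Rightarrow> nat"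
  assumes Z: "Z \<in> measurable M (count_space UNIV)" and bnd: "\<And>x. x \<in> space M \<Longrightarrow> Z x \<le> m"
    and mgf: "\<And>l. (\<integral>x. exp (l * real (Z x)) \<partial>M) \<le> exp ((exp l - 1) * (\<integral>x. real (Z x) \<partial>M))"
    and mean: "(\<integral>x. real (Z x) \<partial>M) \<le> v" and l: "0 < l"
  shows "prob {x\<in>space M. \<bar>real (Z x) - (\<integral>x. real (Z x) \<partial>M)\<bar> > t} \<le> 2 * exp (v * (l\<^sup>2 / 2 * exp l) - l * t)"
proof -
  define \<mu> where "\<mu> = (\<integral>x. real (Z x) \<partial>M)"
  have \<mu>0: "0 \<le> \<mu>" unfolding \<mu>_def by simp
  have [measurable]: "(\<lambda>x. g (Z x)) \<in> borel_measurable M" for g :: "nat \<Rightarrow> real"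
    by (rule measurable_compose[OF Z]) simp
  have int: "integrable M (\<lambda>x. exp (s * real (Z x)))" for s
  proof (rule measurable_bounded_integrable[OF prob_space_axioms])
    fix x assume x: "x \<in> space M"
    have "\<bar>s * real (Z x)\<bar> \<le> \<bar>s\<bar> * real m" unfolding abs_mult using bnd[OF x] by (auto intro: mult_left_mono)
    then show "0 \<le> exp (s * real (Z x)) \<and> exp (s * real (Z x)) \<le> exp (\<bar>s\<bar> * real m)" by auto
  qed measurable
  have sint: "set_integrable M (space M) (\<lambda>x. exp (s * real (Z x)))" for s
    unfolding set_integrable_def by (rule integrable_mult_indicator[OF sets.top int])
  have key: "exp (- (s * \<mu>) - l * t) * (\<integral>x. exp (s * real (Z x)) \<partial>M) \<le> exp (v * (l\<^sup>2 / 2 * exp l) - l * t)"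
    if s: "\<bar>s\<bar> = l" for s
  proof -
    have "exp (- (s * \<mu>) - l * t) * (\<integral>x. exp (s * real (Z x)) \<partial>M) \<le> exp (- (s * \<mu>) - l * t) * exp ((exp s - 1) * \<mu>)"
      unfolding \<mu>_def by (intro mult_left_mono mgf) simp
    also have "\<dots> = exp ((exp s - 1 - s) * \<mu> - l * t)"
      by (simp add: exp_add[symmetric] algebra_simps)
    also have "\<dots> \<le> exp (v * (l\<^sup>2 / 2 * exp l) - l * t)"
    proof -
      have "exp s - 1 - s \<le> l\<^sup>2 / 2 * exp l"
        using exp_quadratic_upper[of s] s power2_abs[of s] by simp
      then have "(exp s - 1 - s) * \<mu> \<le> (l\<^sup>2 / 2 * exp l) * v"
        using \<mu>0 mean l by (intro mult_mono) (auto simp: \<mu>_def)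
      then show ?thesis by (simp add: mult.commute)
    qed
    finally show ?thesis .
  qed
  have up: "prob {x\<in>space M. real (Z x) \<ge> \<mu> + t} \<le> exp (v * (l\<^sup>2 / 2 * exp l) - l * t)"
  proof -
    have "prob {x\<in>space M. real (Z x) \<ge> \<mu> + t} \<le> exp (- l * (\<mu> + t)) * (\<integral>x\<in>space M. exp (l * real (Z x)) \<partial>M)"
      by (rule Chernoff_ineq_ge[OF l]) (simp_all add: sint)
    also have "(\<integral>x\<in>space M. exp (l * real (Z x)) \<partial>M) = (\<integral>x. exp (l * real (Z x)) \<partial>M)"
      by (rule set_integral_space) (rule int)
    also have "exp (- l * (\<mu> + t)) = exp (- (l * \<mu>) - l * t)" by (simp add: algebra_simps)
    finally show ?thesis using key[of l] l by simp
  qed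
  have down: "prob {x\<in>space M. real (Z x) \<le> \<mu> - t} \<le> exp (v * (l\<^sup>2 / 2 * exp l) - l * t)"
  proof -
    have "prob {x\<in>space M. real (Z x) \<le> \<mu> - t} \<le> exp (l * (\<mu> - t)) * (\<integral>x\<in>space M. exp (- l * real (Z x)) \<partial>M)"
      by (rule Chernoff_ineq_le[OF l]) (use sint[of "- l"] in simp_all)
    also have "(\<integral>x\<in>space M. exp (- l * real (Z x)) \<partial>M) = (\<integral>x. exp (- l * real (Z x)) \<partial>M)"
      by (rule set_integral_space) (rule int)
    also have "exp (l * (\<mu> - t)) = exp (- (- l * \<mu>) - l * t)" by (simp add: algebra_simps)
    finally show ?thesis using key[of "- l"] l by simp
  qed
  have "{x\<in>space M. \<bar>real (Z x) - \<mu>\<bar> > t} \<subseteq> {x\<in>space M. real (Z x) \<ge> \<mu> + t} \<union> {x\<in>space M. real (Z x) \<le> \<mu> - t}"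
    by auto
  then have "prob {x\<in>space M. \<bar>real (Z x) - \<mu>\<bar> > t}
      \<le> prob ({x\<in>space M. real (Z x) \<ge> \<mu> + t} \<union> {x\<in>space M. real (Z x) \<le> \<mu> - t})"
    by (rule finite_measure_mono) measurable
  also have "\<dots> \<le> prob {x\<in>space M. real (Z x) \<ge> \<mu> + t} + prob {x\<in>space M. real (Z x) \<le> \<mu> - t}"
    by (rule measure_Un_le) measurable
  finally show ?thesis using up down unfolding \<mu>_def by linarith
qed

context triangle_coords
begin

text \<open>The length never exceeds \<open>n\<close>, so chains of length at least \<open>k\<close>
  add at most \<open>n\<close> times their exponentially small probability.\<close>

lemma expectation_longest_chain_le:
  fixes n k :: nat
  assumes A: "emeasure lborel T = ennreal A" "0 < A" and k: "0 < k" "125 * real n \<le> real k ^ 3"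
  shows "(\<integral>x. real (longest_chain p0 p1 p2 (x ` {..<n})) \<partial>PiM {..<n} (\<lambda>_. uniform_measure lborel T))
    \<le> real k + real n * (66 / 100) ^ k"
proof -
  let ?U = "uniform_measure lborel T"
  define P where "P = PiM {..<n} (\<lambda>_. ?U)"
  define Z where "Z x = longest_chain p0 p1 p2 (x ` {..<n})" for x
  have U: "prob_space ?U" using A by (intro prob_space_uniform_measure) auto
  interpret P: prob_space P unfolding P_def by (rule prob_space_PiM) (rule U)
  have p02: "p0 \<noteq> p2" using dual_p2 by auto
  have Z: "Z \<in> measurable P (count_space UNIV)"
    unfolding P_def Z_def[abs_def] by (rule measurable_longest_chain) (use p02 in auto)
  have Zn: "Z x \<le> n" for x
    using longest_chain_le_card[OF p02, of "{..<n}" p1 x] by (simp add: Z_def)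
  let ?B = "{x\<in>space P. k \<le> Z x}"
  have B: "?B \<in> sets P" using measurable_sets[OF Z, of "{k..}"] by (simp add: vimage_def Int_def conj_commute)
  have "(\<integral>x. real (Z x) \<partial>P) \<le> (\<integral>x. real k + real n * indicator ?B x \<partial>P)"
  proof (rule integral_mono)
    show "integrable P (\<lambda>x. real (Z x))"
    proof (rule measurable_bounded_integrable[OF P.prob_space_axioms])
      show "(\<lambda>x. real (Z x)) \<in> borel_measurable P" by (rule measurable_compose[OF Z]) simp
      show "0 \<le> real (Z x) \<and> real (Z x) \<le> real n" for x using Zn by simp
    qed
    show "integrable P (\<lambda>x. real k + real n * indicator ?B x)"
      using B by (auto simp: P.emeasure_eq_measure)
    show "real (Z x) \<le> real k + real n * indicator ?B x" if "x \<in> space P" for x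
      using that Zn[of x] by (auto simp: indicator_def)
  qed
  also have "\<dots> = real k + real n * P.prob ?B"
    using B by (simp add: P.prob_space P.emeasure_eq_measure)
  also have "P.prob ?B \<le> (66 / 100) ^ k"
    unfolding Z_def P_def
    by (rule order_trans[OF prob_longest_chain_ge_le[OF k(1) A] chain_count_bound[OF k]])
  finally show ?thesis unfolding P_def Z_def by (simp add: mult_left_mono)
qed

lemma longest_chain_deviation:
  fixes n :: nat
  assumes A: "emeasure lborel T = ennreal A" "0 < A"
  defines "P \<equiv> PiM {..<n} (\<lambda>_. uniform_measure lborel T)"
  defines "\<mu> \<equiv> (\<integral>x. real (longest_chain p0 p1 p2 (x ` {..<n})) \<partial>P)"
  assumes v: "\<mu> \<le> v" and l: "0 < l"
  shows "measure P {x\<in>space P. \<bar>real (longest_chain p0 p1 p2 (x ` {..<n})) - \<mu>\<bar> > t}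
    \<le> 2 * exp (v * (l\<^sup>2 / 2 * exp l) - l * t)"
proof -
  let ?U = "uniform_measure lborel T"
  have U: "prob_space ?U" using A by (intro prob_space_uniform_measure) auto
  interpret P: prob_space P unfolding P_def by (rule prob_space_PiM) (rule U)
  have p02: "p0 \<noteq> p2" using dual_p2 by auto
  have meas: "(\<lambda>x. longest_chain p0 p1 p2 (x ` J)) \<in> measurable P (count_space UNIV)" if "J \<subseteq> {..<n}" for J
    unfolding P_def by (rule measurable_longest_chain) (use p02 that in \<open>auto intro: finite_subset\<close>)
  have le: "longest_chain p0 p1 p2 (x ` {..<n}) \<le> n" for x
    using longest_chain_le_card[OF p02, of "{..<n}" p1 x] by simp
  have mgf: "(\<integral>x. exp (l * real (longest_chain p0 p1 p2 (x ` {..<n}))) \<partial>P) \<le> exp ((exp l - 1) * \<mu>)" for l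
    unfolding P_def \<mu>_def
  proof (rule self_bounding_mgf[where Z' = "\<lambda>i x. longest_chain p0 p1 p2 (x ` ({..<n} - {i}))" and m = n, OF U])
    fix i x
    show "coord_invariant ?U {..<n} i (\<lambda>x. longest_chain p0 p1 p2 (x ` ({..<n} - {i})))"
    proof -
      have "x(i := y) ` ({..<n} - {i}) = x ` ({..<n} - {i})" for x :: "nat \<Rightarrow> real ^ 2" and y by auto
      then show ?thesis by (simp add: coord_invariant_def)
    qed
    show "longest_chain p0 p1 p2 (x ` ({..<n} - {i})) \<le> longest_chain p0 p1 p2 (x ` {..<n}) \<and>
      longest_chain p0 p1 p2 (x ` {..<n}) \<le> longest_chain p0 p1 p2 (x ` ({..<n} - {i})) + 1"
      using longest_chain_remove[OF p02, of "{..<n}"] by (auto intro!: longest_chain_mono[OF p02])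
    show "(\<Sum>i<n. longest_chain p0 p1 p2 (x ` {..<n}) - longest_chain p0 p1 p2 (x ` ({..<n} - {i})))
      \<le> longest_chain p0 p1 p2 (x ` {..<n})"
      by (rule longest_chain_self_bounding[OF p02]) simp
  qed (use meas le in \<open>auto simp: P_def\<close>)
  show ?thesis
    using P.poisson_type_deviation[of "\<lambda>x. longest_chain p0 p1 p2 (x ` {..<n})" n v l t] meas le mgf v l
    unfolding \<mu>_def by auto
qed

end

text \<open>Carries an arbitrary sample over to the product measure. Since \<open>n > 0\<close>, the
  variable \<open>X 0\<close> exists, and its law shows that the uniform measure is a probability
  measure.\<close>

lemma uniform_sample_joint_distr:
  assumes s: "uniform_sample M T n X" and n: "0 < n"
  shows "distr M (PiM {..<n} (\<lambda>_. borel)) (\<lambda>\<omega>. \<lambda>i\<in>{..<n}. X i \<omega>) = PiM {..<n} (\<lambda>_. uniform_measure lborel T)"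
    and "prob_space (uniform_measure lborel T)" and "\<And>i. i < n \<Longrightarrow> X i \<in> borel_measurable M"
proof -
  interpret prob_space M using s by (simp add: uniform_sample_def)
  have ind: "indep_vars (\<lambda>_. borel) X {..<n}" using s by (simp add: uniform_sample_def)
  then show X: "X i \<in> borel_measurable M" if "i < n" for i
    using that by (auto simp: indep_vars_def)
  have d: "distr M borel (X i) = uniform_measure lborel T" if "i < n" for i
  proof -
    have "distr M borel (X i) = distr M lborel (X i)" by (rule distr_cong) auto
    then show ?thesis using s that by (simp add: uniform_sample_def)
  qed
  have "distr M (PiM {..<n} (\<lambda>_. borel)) (\<lambda>\<omega>. \<lambda>i\<in>{..<n}. X i \<omega>) = PiM {..<n} (\<lambda>i. distr M borel (X i))"
    using indep_vars_iff_distr_eq_PiM'[where I = "{..<n}" and M' = "\<lambda>_. borel" and X = X] ind X n by auto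
  also have "\<dots> = PiM {..<n} (\<lambda>_. uniform_measure lborel T)"
    by (rule PiM_cong) (auto simp: d)
  finally show "distr M (PiM {..<n} (\<lambda>_. borel)) (\<lambda>\<omega>. \<lambda>i\<in>{..<n}. X i \<omega>) = PiM {..<n} (\<lambda>_. uniform_measure lborel T)" .
  show "prob_space (uniform_measure lborel T)"
    using prob_space_distr[OF X[OF n]] d[OF n] by simp
qed

theorem theorem1p2:
  fixes p0 p1 p2 :: "real ^ 2" and \<gamma> :: real
  assumes "\<not> collinear {p0, p1, p2}" and "\<gamma> > 0"
  shows "\<exists>N::nat. \<forall>n>N. \<forall>(M :: 'w measure) X.
    uniform_sample M (triangle_hull p0 p1 p2) n X \<longrightarrow>
    (let L = chain_length p0 p1 p2 n X in
      measure M {\<omega> \<in> space M.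
          \<bar>L \<omega> - (\<integral>\<omega>'. L \<omega>' \<partial>M)\<bar> > \<gamma> * sqrt (ln (real n)) * real n powr (1 / 6)}
        < real n powr (- (\<gamma>\<^sup>2 / 14)))"
proof -
  obtain a b where "triangle_coords p0 p1 p2 a b"
    using triangle_dual_basis[OF assms(1)] unfolding triangle_coords_def by blast
  then interpret triangle_coords p0 p1 p2 a b .
  define t where "t n = \<gamma> * sqrt (ln (real n)) * real n powr (1 / 6)" for n :: nat
  \<comment> \<open>The bound on the mean: \<open>5 n^(1/3)\<close>, plus 1 for rounding up
    \<open>k\<close>, plus a vanishing term, enlarged to a pure multiple of
    \<open>n^(1/3)\<close>.\<close>
  define v where "v n = 55 / 10 * real n powr (1 / 3)" for n :: nat
  have "\<forall>\<^sub>F n :: nat in sequentially. 5 * real n powr (1/3) + 1 + real n * (66/100) powr (5 * real n powr (1/3)) \<le> v n"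
    unfolding v_def by real_asymp
  moreover have "\<forall>\<^sub>F n :: nat in sequentially. exp (t n / v n) \<le> 11 / 10"
    unfolding t_def v_def using assms(2) by real_asymp
  \<comment> \<open>With \<open>exp l \<le> 1.1\<close> the exponent is at least
    \<open>\<gamma>\<^sup>2 ln n\<close> times \<open>0.45 / 5.5\<close>, which exceeds 0.08. The
    margin of 0.08 over \<open>1/14\<close> absorbs the factor 2 of the two tails once
    \<open>n\<close> is large.\<close>
  moreover have "\<forall>\<^sub>F n :: nat in sequentially. ln 2 < (8/100 - 1/14) * \<gamma>\<^sup>2 * ln (real n)"
    using assms(2) by real_asymp
  moreover have "\<forall>\<^sub>F n :: nat in sequentially. 1 < n" by (rule eventually_gt_at_top)
  ultimately have "\<forall>\<^sub>F n :: nat in sequentially.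
      5 * real n powr (1/3) + 1 + real n * (66/100) powr (5 * real n powr (1/3)) \<le> v n \<and>
      exp (t n / v n) \<le> 11 / 10 \<and> ln 2 < (8/100 - 1/14) * \<gamma>\<^sup>2 * ln (real n) \<and> 1 < n"
    by eventually_elim auto
  \<comment> \<open>These conditions involve only \<open>n\<close> and \<open>\<gamma>\<close>, so
    \<open>N\<close> is fixed before the probability space and the sample.\<close>
  then obtain N where N: "\<And>n. N \<le> n \<Longrightarrow>
      5 * real n powr (1/3) + 1 + real n * (66/100) powr (5 * real n powr (1/3)) \<le> v n \<and>
      exp (t n / v n) \<le> 11 / 10 \<and> ln 2 < (8/100 - 1/14) * \<gamma>\<^sup>2 * ln (real n) \<and> 1 < n"
    unfolding eventually_sequentially by blast
  show ?thesis
  proof (intro exI[of _ N] allI impI)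
    fix n :: nat and M :: "'w measure" and X
    assume "N < n" and s: "uniform_sample M T n X"
    then have large: "5 * real n powr (1/3) + 1 + real n * (66/100) powr (5 * real n powr (1/3)) \<le> v n"
      "exp (t n / v n) \<le> 11 / 10" "ln 2 < (8/100 - 1/14) * \<gamma>\<^sup>2 * ln (real n)" "1 < n"
      using N[of n] by auto
    then have n: "0 < n" by simp
    note joint = uniform_sample_joint_distr[OF s n]
    define P where "P = PiM {..<n} (\<lambda>_. uniform_measure lborel T)"
    define Z where "Z x = longest_chain p0 p1 p2 (x ` {..<n})" for x
    define \<mu> where "\<mu> = (\<integral>x. real (Z x) \<partial>P)"
    \<comment> \<open>Positivity of the area is read off from the sample: the uniform measure on a
      null set would vanish, yet it is the law of a random point.\<close>
    obtain A where A: "emeasure lborel T = ennreal A" "0 < A"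
    proof -
      interpret U: prob_space "uniform_measure lborel T" by (rule joint(2))
      have "emeasure lborel T < \<infinity>" using compact_triangle_hull by (rule emeasure_compact_finite)
      then obtain A where A: "emeasure lborel T = ennreal A" "0 \<le> A"
        by (cases "emeasure lborel T") auto
      have "A \<noteq> 0"
      proof
        assume "A = 0"
        then have "emeasure (uniform_measure lborel T) UNIV = 0"
          using A triangle_borel by (simp add: emeasure_uniform_measure)
        then show False using U.emeasure_space_1 by simp
      qed
      then show ?thesis using A by (intro that) auto
    qed
    have mean: "\<mu> \<le> v n"
    proof -
      define k where "k = nat \<lceil>5 * real n powr (1/3)\<rceil>"
      have pos: "0 < real n powr (1/3)" using n by simp
      have k: "5 * real n powr (1/3) \<le> real k" "real k \<le> 5 * real n powr (1/3) + 1" "0 < k"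
        unfolding k_def using pos by linarith+
      have "(5 * real n powr (1/3)) ^ 3 \<le> real k ^ 3" using k pos by (intro power_mono) auto
      moreover have "(real n powr (1/3)) ^ 3 = real n"
        using n by (simp add: powr_power)
      ultimately have "125 * real n \<le> real k ^ 3" by (simp add: power_mult_distrib)
      then have "\<mu> \<le> real k + real n * (66 / 100) ^ k"
        unfolding \<mu>_def Z_def P_def by (intro expectation_longest_chain_le[OF A k(3)])
      also have "(66 / 100 :: real) ^ k = (66 / 100) powr real k" by (simp add: powr_realpow)
      also have "\<dots> \<le> (66 / 100) powr (5 * real n powr (1/3))"
        by (rule powr_mono') (use k in auto)
      finally have "\<mu> \<le> real k + real n * (66 / 100) powr (5 * real n powr (1/3))"
        by (simp add: mult_left_mono)
      then show ?thesis using k(2) large(1) by linarith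
    qed
    have v0: "0 < v n" using n by (simp add: v_def)
    have t0: "0 < t n" using large(4) assms(2) by (simp add: t_def)
    \<comment> \<open>The minimizer of \<open>v l^2 / 2 - l t\<close>. It tends to 0 with growing
      \<open>n\<close>, so the additional factor \<open>exp l\<close> is harmless.\<close>
    define l where "l = t n / v n"
    have l: "0 < l" using v0 t0 by (simp add: l_def)
    have "measure P {x\<in>space P. \<bar>real (Z x) - \<mu>\<bar> > t n} \<le> 2 * exp (v n * (l\<^sup>2 / 2 * exp l) - l * t n)"
      unfolding P_def Z_def \<mu>_def
      by (rule longest_chain_deviation[OF A _ l]) (use mean in \<open>simp add: \<mu>_def Z_def P_def\<close>)
    also have "\<dots> \<le> 2 * exp (- (8 / 100 * \<gamma>\<^sup>2 * ln n))"
    proof -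
      have "v n * (l\<^sup>2 / 2 * exp l) - l * t n = - ((t n)\<^sup>2 / v n) * (1 - exp l / 2)"
        using v0 by (simp add: l_def power2_eq_square field_simps)
      also have "(t n)\<^sup>2 / v n = \<gamma>\<^sup>2 * ln n / (55 / 10)"
      proof -
        have "(real n powr (1/6))\<^sup>2 = real n powr (1/3)"
          by (simp add: power2_eq_square flip: powr_add)
        then have "(t n)\<^sup>2 = \<gamma>\<^sup>2 * ln n * real n powr (1/3)"
          using n by (simp add: t_def power_mult_distrib)
        then show ?thesis using n by (simp add: v_def)
      qed
      also have "- (\<gamma>\<^sup>2 * ln n / (55 / 10)) * (1 - exp l / 2) \<le> - (\<gamma>\<^sup>2 * ln n / (55 / 10)) * (45 / 100)"
        using large(2) n by (intro mult_left_mono_neg) (auto simp: l_def)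
      also have "\<dots> \<le> - (8 / 100 * \<gamma>\<^sup>2 * ln n)"
      proof -
        have "0 \<le> \<gamma>\<^sup>2 * ln n" using n by simp
        then show ?thesis by (simp add: mult.commute)
      qed
      finally show ?thesis by simp
    qed
    also have "\<dots> < real n powr (- (\<gamma>\<^sup>2 / 14))"
    proof -
      have "2 * exp (- y) = exp (ln 2 - y)" for y :: real
        by (simp add: exp_diff exp_minus divide_inverse)
      then have "2 * exp (- (8 / 100 * \<gamma>\<^sup>2 * ln n)) = exp (ln 2 - 8 / 100 * \<gamma>\<^sup>2 * ln n)" .
      also have "\<dots> < exp (- (\<gamma>\<^sup>2 / 14) * ln n)"
        using large(3) by (simp add: algebra_simps)
      finally show ?thesis using n by (simp add: powr_def)
    qed
    finally have main: "measure P {x\<in>space P. \<bar>real (Z x) - \<mu>\<bar> > t n} < real n powr (- (\<gamma>\<^sup>2 / 14))" .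
    \<comment> \<open>The length depends on the sample only through the tuple of its points, so the
      mean and the deviation event are both transported by the joint law.\<close>
    let ?B = "PiM {..<n} (\<lambda>_. borel :: (real ^ 2) measure)" and ?X = "\<lambda>\<omega>. \<lambda>i\<in>{..<n}. X i \<omega>"
    have PB: "distr M ?B ?X = P" using joint(1) by (simp add: P_def)
    have X: "?X \<in> measurable M ?B" by (rule measurable_restrict) (use joint(3) in auto)
    have L: "chain_length p0 p1 p2 n X \<omega> = real (Z (?X \<omega>))" for \<omega>
      by (simp add: chain_length_def Z_def)
    have "p0 \<noteq> p2" using dual_p2 by auto
    then have "Z \<in> measurable ?B (count_space UNIV)"
      unfolding Z_def[abs_def] by (intro measurable_longest_chain) auto
    then have ZB: "(\<lambda>x. real (Z x)) \<in> borel_measurable ?B"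
      by (rule measurable_compose) simp
    have E: "(\<integral>\<omega>. chain_length p0 p1 p2 n X \<omega> \<partial>M) = \<mu>"
      unfolding L \<mu>_def PB[symmetric] by (rule integral_distr[OF X ZB, symmetric])
    have "{x\<in>space ?B. \<bar>real (Z x) - \<mu>\<bar> > t n} \<in> sets ?B" using ZB by measurable
    then have "measure (distr M ?B ?X) {x\<in>space ?B. \<bar>real (Z x) - \<mu>\<bar> > t n}
      = measure M (?X -` {x\<in>space ?B. \<bar>real (Z x) - \<mu>\<bar> > t n} \<inter> space M)"
      by (rule measure_distr[OF X])
    also have "?X -` {x\<in>space ?B. \<bar>real (Z x) - \<mu>\<bar> > t n} \<inter> space M
      = {\<omega>\<in>space M. \<bar>chain_length p0 p1 p2 n X \<omega> - \<mu>\<bar> > t n}"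
      using measurable_space[OF X] by (auto simp: L)
    also have "space ?B = space P" using PB by (metis space_distr)
    finally have "measure M {\<omega>\<in>space M. \<bar>chain_length p0 p1 p2 n X \<omega> - \<mu>\<bar> > t n} < real n powr (- (\<gamma>\<^sup>2 / 14))"
      using main unfolding PB by simp
    then show "let L = chain_length p0 p1 p2 n X in
      measure M {\<omega> \<in> space M.
          \<bar>L \<omega> - (\<integral>\<omega>'. L \<omega>' \<partial>M)\<bar> > \<gamma> * sqrt (ln (real n)) * real n powr (1 / 6)}
        < real n powr (- (\<gamma>\<^sup>2 / 14))"
      unfolding Let_def E t_def .
  qed
qed

end
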